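(* Let $\mathcal C$ be a fine tree decomposition of a compact metric space $K$. Then the associated tree system $\Theta_{\mathcal C}$ is a tree system of metric compacta, and its limit $\lim\Theta_{\mathcal C}$ is homeomorphic to $K$, via the map which is the identity on each domain $\Omega$ (a constituent space of $\Theta_{\mathcal C}$, viewed as a subset of $K$) and which sends the end of $T_{\mathcal C}$ represented by a ray $((A_1,H_1),(A_2,H_2),\dots)$ to the unique point of $\bigcap_i H_i$.
   Context: Trees: for a tree $T$, $V_T$ is its vertex set and $O_T$ its set of oriented edges; each $e\in O_T$ has initial vertex $\alpha(e)$, terminal vertex $\omega(e)$, and $\bar e$ denotes the reversed edge; $N_t=\{e:\alpha(e)=t\}$. A family of subsets of a compact metric space is null if for every $\epsilon>0$ only finitely many members have diameter $\ge\epsilon$. A tree system of metric compacta is $\Theta=(T,\{K_t\},\{\Sigma_e\},\{\phi_e\})$ with $T$ a countable tree, $K_t$ compact metric spaces, $\Sigma_e$ nonempty compact subsets of $K_{\alpha(e)}$, homeomorphisms $\phi_e:\Sigma_e\to\Sigma_{\bar e}$ with $\phi_{\bar e}=\phi_e^{-1}$, and each $\{\Sigma_e:e\in N_t\}$ a null family of pairwise disjoint sets. Its limit $\lim\Theta$: as a set, the quotient of $\bigsqcup_tK_t$ by $x\sim\phi_e(x)$, disjoint union with the set $E_T$ of ends of $T$; topology with basis the sets $G(U)$, where for a finite subtree $F$ with partial union $K_F$ (quotient of $\bigsqcup_{t\in V_F}K_t$ by the gluings along edges of $F$) and $N_F=\{e:\alpha(e)\in F,\omega(e)\notin F\}$,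 $U$ is an open subset of $K_F$ such that each $\Sigma_e$ ($e\in N_F$) is contained in or disjoint from $U$, and $G(U)$ is the union of $U$, all $K_t$ beyond edges $e\in N_F$ with $\Sigma_e\subset U$ (i.e. the shortest path from $F$ to $t$ starts with $e$), and all ends of rays leaving $F$ through such edges. Splittings: an elementary splitting of $K$ is a triple $(A,\{Y,Z\})$ of compact subsets with $Y\cup Z=K$, $Y\cap Z=A$, and $A$ a nonempty proper subset of both $Y$ and $Z$; $A$ is the separator, $Y,Z$ the halfspaces; for a halfspace $H$, $\dot H=H\setminus A$ and $H^c$ is the other halfspace. Two splittings do not cross if some halfspace of one is disjoint from some halfspace of the other. For pairwise noncrossing splittings, a separator $A'$ separates $A$ from $A''$ if for some halfspace $H$ of $A'$ we have $A\subset\dot H$ and $A''\subset\dot H^c$. A tree decomposition of $K$ is a family $\mathcal C=\{(A_\lambda,\{Y_\lambda,Z_\lambda\})\}_{\lambda\in\Lambda}$ of pairwise noncrossing elementary splittings which is discrete: for any two separators only finitely many separators separate them. It is fine if for each $\epsilon>0$ only finitely many $\lambda$ satisfy $\min(\mathrm{diam}Y_\lambda,\mathrm{diam}Z_\lambda)>\epsilon$. Domains: for a separator $A$ of $\mathcal C$ and a halfspace $H$ of it, let, for each $\lambda$ with $A_\lambda\ne A$, $H_\lambda$ be the halfspace of $A_\lambda$ containing $A$; let $\Lambda_{A,H}$ be the set of $\lambda$ with $H\not\subset H_\lambda$ such that no separator separates $A$ from $A_\lambda$; put $\Omega_{A,H}=H\cap\bigcap_{\lambda\in\Lambda_{A,H}}H_\lambda$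 ($=H$ if $\Lambda_{A,H}=\emptyset$). These sets are the domains. The dual tree $T_{\mathcal C}$ has the domains as vertices and pairs $(A,H)$ ($A$ a separator, $H$ one of its halfspaces) as oriented edges, with $\omega(A,H)=\Omega_{A,H}$ and $\overline{(A,H)}=(A,H^c)$ (so $\alpha(A,H)=\Omega_{A,H^c}$). The associated tree system $\Theta_{\mathcal C}$ has underlying tree $T_{\mathcal C}$, constituent space $\Omega$ at vertex $\Omega$, peripheral subspace $\Sigma_{(A,H)}=A$, and connecting maps $\phi_{(A,H)}=\mathrm{id}_A$. *)

theory Defs
  imports "HOL-Analysis.Analysis"
begin

text \<open>A graph is given by a vertex set V, a set Ed of oriented edges, initial/terminal
  vertex maps al (alpha) and om (omega), and the edge reversal rv (e bar).\<close>

fun epath :: "('e \<Rightarrow> 'v) \<Rightarrow> ('e \<Rightarrow> 'v) \<Rightarrow> 'e set \<Rightarrow> 'v \<Rightarrow> 'e list \<Rightarrow> 'v \<Rightarrow> bool" where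
  "epath al om Ed u [] v = (u = v)"
| "epath al om Ed u (e # p) v = (e \<in> Ed \<and> al e = u \<and> epath al om Ed (om e) p v)"

fun reduced :: "('e \<Rightarrow> 'e) \<Rightarrow> 'e list \<Rightarrow> bool" where
  "reduced rv (e # f # p) = (f \<noteq> rv e \<and> reduced rv (f # p))"
| "reduced rv _ = True"

definition is_graph :: "'v set \<Rightarrow> 'e set \<Rightarrow> ('e \<Rightarrow> 'v) \<Rightarrow> ('e \<Rightarrow> 'v) \<Rightarrow> ('e \<Rightarrow> 'e) \<Rightarrow> bool" where
  "is_graph V Ed al om rv \<longleftrightarrow>
     (\<forall>e\<in>Ed. al e \<in> V \<and> om e \<in> V \<and> rv e \<in> Ed \<and> rv (rv e) = e \<and> rv e \<noteq> e \<and> al (rv e) = om e)"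

definition is_tree :: "'v set \<Rightarrow> 'e set \<Rightarrow> ('e \<Rightarrow> 'v) \<Rightarrow> ('e \<Rightarrow> 'v) \<Rightarrow> ('e \<Rightarrow> 'e) \<Rightarrow> bool" where
  "is_tree V Ed al om rv \<longleftrightarrow> is_graph V Ed al om rv \<and>
     (\<forall>u\<in>V. \<forall>v\<in>V. \<exists>!p. epath al om Ed u p v \<and> reduced rv p)"

definition countable_tree :: "'v set \<Rightarrow> 'e set \<Rightarrow> ('e \<Rightarrow> 'v) \<Rightarrow> ('e \<Rightarrow> 'v) \<Rightarrow> ('e \<Rightarrow> 'e) \<Rightarrow> bool" where
  "countable_tree V Ed al om rv \<longleftrightarrow> is_tree V Ed al om rv \<and> countable V"

definition out_edges_at :: "'e set \<Rightarrow> ('e \<Rightarrow> 'v) \<Rightarrow> 'v \<Rightarrow> 'e set" where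
  "out_edges_at Ed al t = {e \<in> Ed. al e = t}"

definition finite_subtree :: "'v set \<Rightarrow> 'e set \<Rightarrow> ('e \<Rightarrow> 'v) \<Rightarrow> ('e \<Rightarrow> 'v) \<Rightarrow> ('e \<Rightarrow> 'e) \<Rightarrow> 'v set \<Rightarrow> bool" where
  "finite_subtree V Ed al om rv F \<longleftrightarrow> F \<subseteq> V \<and> F \<noteq> {} \<and> finite F \<and>
     (\<forall>u\<in>F. \<forall>v\<in>F. \<forall>p. epath al om Ed u p v \<and> reduced rv p \<longrightarrow> (\<forall>e\<in>set p. om e \<in> F))"

definition leaving_edges :: "'e set \<Rightarrow> ('e \<Rightarrow> 'v) \<Rightarrow> ('e \<Rightarrow> 'v) \<Rightarrow> 'v set \<Rightarrow> 'e set" where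
  "leaving_edges Ed al om F = {e \<in> Ed. al e \<in> F \<and> om e \<notin> F}"

definition beyond :: "'e set \<Rightarrow> ('e \<Rightarrow> 'v) \<Rightarrow> ('e \<Rightarrow> 'v) \<Rightarrow> ('e \<Rightarrow> 'e) \<Rightarrow> 'v set \<Rightarrow> 'e \<Rightarrow> 'v \<Rightarrow> bool" where
  "beyond Ed al om rv F e t \<longleftrightarrow>
     (\<exists>p. epath al om Ed (al e) (e # p) t \<and> reduced rv (e # p) \<and> (\<forall>f\<in>set (e # p). om f \<notin> F))"

definition is_ray :: "'e set \<Rightarrow> ('e \<Rightarrow> 'v) \<Rightarrow> ('e \<Rightarrow> 'v) \<Rightarrow> ('e \<Rightarrow> 'e) \<Rightarrow> (nat \<Rightarrow> 'e) \<Rightarrow> bool" where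
  "is_ray Ed al om rv r \<longleftrightarrow>
     (\<forall>i. r i \<in> Ed \<and> om (r i) = al (r (Suc i)) \<and> r (Suc i) \<noteq> rv (r i))"

definition ray_equiv :: "(nat \<Rightarrow> 'e) \<Rightarrow> (nat \<Rightarrow> 'e) \<Rightarrow> bool" where
  "ray_equiv r r' \<longleftrightarrow> (\<exists>m n. \<forall>k. r (m + k) = r' (n + k))"

definition ends :: "'e set \<Rightarrow> ('e \<Rightarrow> 'v) \<Rightarrow> ('e \<Rightarrow> 'v) \<Rightarrow> ('e \<Rightarrow> 'e) \<Rightarrow> (nat \<Rightarrow> 'e) set set" where
  "ends Ed al om rv =
     {{r'. is_ray Ed al om rv r' \<and> ray_equiv r r'} | r. is_ray Ed al om rv r}"

text \<open>All constituent spaces are taken to be subsets of one metric type 'a (with the induced metric).\<close>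
definition tree_system ::
  "'v set \<Rightarrow> 'e set \<Rightarrow> ('e \<Rightarrow> 'v) \<Rightarrow> ('e \<Rightarrow> 'v) \<Rightarrow> ('e \<Rightarrow> 'e) \<Rightarrow>
   ('v \<Rightarrow> 'a::metric_space set) \<Rightarrow> ('e \<Rightarrow> 'a set) \<Rightarrow> ('e \<Rightarrow> 'a \<Rightarrow> 'a) \<Rightarrow> bool" where
  "tree_system V Ed al om rv Kt Sig phi \<longleftrightarrow>
     countable_tree V Ed al om rv \<and>
     (\<forall>t\<in>V. compact (Kt t)) \<and>
     (\<forall>e\<in>Ed. Sig e \<noteq> {} \<and> compact (Sig e) \<and> Sig e \<subseteq> Kt (al e) \<and>
        homeomorphic_map (top_of_set (Sig e)) (top_of_set (Sig (rv e))) (phi e) \<and>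
        (\<forall>x\<in>Sig e. phi (rv e) (phi e x) = x)) \<and>
     (\<forall>t\<in>V. (\<forall>e\<in>out_edges_at Ed al t. \<forall>e'\<in>out_edges_at Ed al t. e \<noteq> e' \<longrightarrow> Sig e \<inter> Sig e' = {}) \<and>
            (\<forall>\<epsilon>>0. finite {e \<in> out_edges_at Ed al t. diameter (Sig e) \<ge> \<epsilon>}))"

definition dunion :: "'v set \<Rightarrow> ('v \<Rightarrow> 'a set) \<Rightarrow> ('v \<times> 'a) set" where
  "dunion V Kt = (SIGMA t:V. Kt t)"

definition glue :: "'e set \<Rightarrow> ('e \<Rightarrow> 'v) \<Rightarrow> ('e \<Rightarrow> 'v) \<Rightarrow> ('e \<Rightarrow> 'a set) \<Rightarrow> ('e \<Rightarrow> 'a \<Rightarrow> 'a)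
    \<Rightarrow> (('v \<times> 'a) \<times> ('v \<times> 'a)) set" where
  "glue Ed al om Sig phi = {((al e, x), (om e, phi e x)) | e x. e \<in> Ed \<and> x \<in> Sig e}"

definition lim_rel ::
  "'v set \<Rightarrow> 'e set \<Rightarrow> ('e \<Rightarrow> 'v) \<Rightarrow> ('e \<Rightarrow> 'v) \<Rightarrow> ('v \<Rightarrow> 'a set) \<Rightarrow> ('e \<Rightarrow> 'a set) \<Rightarrow> ('e \<Rightarrow> 'a \<Rightarrow> 'a)
   \<Rightarrow> (('v \<times> 'a) \<times> ('v \<times> 'a)) set" where
  "lim_rel V Ed al om Kt Sig phi =
     (Id_on (dunion V Kt) \<union> glue Ed al om Sig phi \<union> (glue Ed al om Sig phi)\<inverse>)\<^sup>*"

definition lim_points ::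
  "'v set \<Rightarrow> 'e set \<Rightarrow> ('e \<Rightarrow> 'v) \<Rightarrow> ('e \<Rightarrow> 'v) \<Rightarrow> ('e \<Rightarrow> 'e) \<Rightarrow> ('v \<Rightarrow> 'a set) \<Rightarrow> ('e \<Rightarrow> 'a set) \<Rightarrow> ('e \<Rightarrow> 'a \<Rightarrow> 'a)
   \<Rightarrow> (('v \<times> 'a) set + (nat \<Rightarrow> 'e) set) set" where
  "lim_points V Ed al om rv Kt Sig phi =
     Inl ` (dunion V Kt // lim_rel V Ed al om Kt Sig phi) \<union> Inr ` ends Ed al om rv"

text \<open>Admissible pairs (F, U): F a finite subtree and U an open subset of the partial union K_F,
  represented by its (saturated) preimage in the disjoint union of the K_t, t in F
  (quotient topology), such that each Sigma_e, e in N_F, is contained in or disjoint from U.\<close>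
definition admissible ::
  "'v set \<Rightarrow> 'e set \<Rightarrow> ('e \<Rightarrow> 'v) \<Rightarrow> ('e \<Rightarrow> 'v) \<Rightarrow> ('e \<Rightarrow> 'e) \<Rightarrow> ('v \<Rightarrow> 'a::topological_space set) \<Rightarrow> ('e \<Rightarrow> 'a set) \<Rightarrow> ('e \<Rightarrow> 'a \<Rightarrow> 'a)
   \<Rightarrow> 'v set \<Rightarrow> ('v \<times> 'a) set \<Rightarrow> bool" where
  "admissible V Ed al om rv Kt Sig phi F U \<longleftrightarrow>
     finite_subtree V Ed al om rv F \<and>
     U \<subseteq> (SIGMA t:F. Kt t) \<and>
     (\<forall>t\<in>F. openin (top_of_set (Kt t)) {x. (t, x) \<in> U}) \<and>
     (\<forall>e\<in>Ed. al e \<in> F \<and> om e \<in> F \<longrightarrow> (\<forall>x\<in>Sig e. (al e, x) \<in> U \<longleftrightarrow> (om e, phi e x) \<in> U)) \<and>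
     (\<forall>e\<in>leaving_edges Ed al om F. (\<forall>x\<in>Sig e. (al e, x) \<in> U) \<or> (\<forall>x\<in>Sig e. (al e, x) \<notin> U))"

definition Gset ::
  "'v set \<Rightarrow> 'e set \<Rightarrow> ('e \<Rightarrow> 'v) \<Rightarrow> ('e \<Rightarrow> 'v) \<Rightarrow> ('e \<Rightarrow> 'e) \<Rightarrow> ('v \<Rightarrow> 'a set) \<Rightarrow> ('e \<Rightarrow> 'a set) \<Rightarrow> ('e \<Rightarrow> 'a \<Rightarrow> 'a)
   \<Rightarrow> 'v set \<Rightarrow> ('v \<times> 'a) set \<Rightarrow> (('v \<times> 'a) set + (nat \<Rightarrow> 'e) set) set" where
  "Gset V Ed al om rv Kt Sig phi F U =
     {Inl c | c. c \<in> dunion V Kt // lim_rel V Ed al om Kt Sig phi \<and>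
        (\<exists>(t, x)\<in>c. (t, x) \<in> U \<or>
           (\<exists>e\<in>leaving_edges Ed al om F. (\<forall>y\<in>Sig e. (al e, y) \<in> U) \<and> beyond Ed al om rv F e t))}
     \<union> {Inr \<xi> | \<xi>. \<xi> \<in> ends Ed al om rv \<and>
        (\<exists>r\<in>\<xi>. r 0 \<in> leaving_edges Ed al om F \<and> (\<forall>y\<in>Sig (r 0). (al (r 0), y) \<in> U) \<and>
                 (\<forall>i\<ge>1. al (r i) \<notin> F))}"

definition lim_top ::
  "'v set \<Rightarrow> 'e set \<Rightarrow> ('e \<Rightarrow> 'v) \<Rightarrow> ('e \<Rightarrow> 'v) \<Rightarrow> ('e \<Rightarrow> 'e) \<Rightarrow> ('v \<Rightarrow> 'a::topological_space set) \<Rightarrow> ('e \<Rightarrow> 'a set) \<Rightarrow> ('e \<Rightarrow> 'a \<Rightarrow> 'a)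
   \<Rightarrow> (('v \<times> 'a) set + (nat \<Rightarrow> 'e) set) topology" where
  "lim_top V Ed al om rv Kt Sig phi =
     topology_generated_by
       {Gset V Ed al om rv Kt Sig phi F U | F U. admissible V Ed al om rv Kt Sig phi F U}"

definition elem_splitting :: "'a::topological_space set \<Rightarrow> 'a set \<times> 'a set set \<Rightarrow> bool" where
  "elem_splitting K s \<longleftrightarrow> (\<exists>Y Z. snd s = {Y, Z} \<and> compact (fst s) \<and> compact Y \<and> compact Z \<and>
      Y \<union> Z = K \<and> Y \<inter> Z = fst s \<and> fst s \<noteq> {} \<and> fst s \<subset> Y \<and> fst s \<subset> Z)"

definition no_cross :: "'a set \<times> 'a set set \<Rightarrow> 'a set \<times> 'a set set \<Rightarrow> bool" where
  "no_cross s s' \<longleftrightarrow> (\<exists>H\<in>snd s. \<exists>H'\<in>snd s'. H \<inter> H' = {})"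

definition seps :: "('a set \<times> 'a set set) set \<Rightarrow> 'a set set" where
  "seps C = fst ` C"

definition halfsp :: "('a set \<times> 'a set set) set \<Rightarrow> 'a set \<Rightarrow> 'a set set" where
  "halfsp C A = {H. \<exists>P. (A, P) \<in> C \<and> H \<in> P}"

definition other :: "('a set \<times> 'a set set) set \<Rightarrow> 'a set \<Rightarrow> 'a set \<Rightarrow> 'a set" where
  "other C A H = (THE H'. H' \<in> halfsp C A \<and> H' \<noteq> H)"

definition separates :: "('a set \<times> 'a set set) set \<Rightarrow> 'a set \<Rightarrow> 'a set \<Rightarrow> 'a set \<Rightarrow> bool" where
  "separates C A' A A'' \<longleftrightarrow>
     (\<exists>H\<in>halfsp C A'. A \<subseteq> H - A' \<and> A'' \<subseteq> other C A' H - A')"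

definition tree_decomposition :: "'a::topological_space set \<Rightarrow> ('a set \<times> 'a set set) set \<Rightarrow> bool" where
  "tree_decomposition K C \<longleftrightarrow>
     (\<forall>s\<in>C. elem_splitting K s) \<and>
     (\<forall>s\<in>C. \<forall>s'\<in>C. s \<noteq> s' \<longrightarrow> no_cross s s') \<and>
     (\<forall>A\<in>seps C. \<forall>A''\<in>seps C. finite {A' \<in> seps C. separates C A' A A''})"

definition fine_decomposition :: "('a::metric_space set \<times> 'a set set) set \<Rightarrow> bool" where
  "fine_decomposition C \<longleftrightarrow> (\<forall>\<epsilon>>0. finite {s \<in> C. \<forall>H\<in>snd s. diameter H > \<epsilon>})"

definition hs_containing :: "('a set \<times> 'a set set) set \<Rightarrow> 'a set \<Rightarrow> 'a set \<Rightarrow> 'a set" where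
  "hs_containing C A A' = (THE H'. H' \<in> halfsp C A' \<and> A \<subseteq> H')"

definition Lam :: "('a set \<times> 'a set set) set \<Rightarrow> 'a set \<Rightarrow> 'a set \<Rightarrow> 'a set set" where
  "Lam C A H = {A' \<in> seps C. A' \<noteq> A \<and> \<not> H \<subseteq> hs_containing C A A' \<and>
                 \<not> (\<exists>B\<in>seps C. separates C B A A')}"

definition Omega :: "('a set \<times> 'a set set) set \<Rightarrow> 'a set \<Rightarrow> 'a set \<Rightarrow> 'a set" where
  "Omega C A H = H \<inter> \<Inter> (hs_containing C A ` Lam C A H)"

definition dual_V :: "('a set \<times> 'a set set) set \<Rightarrow> 'a set set" where
  "dual_V C = {Omega C A H | A H. A \<in> seps C \<and> H \<in> halfsp C A}"

definition dual_O :: "('a set \<times> 'a set set) set \<Rightarrow> ('a set \<times> 'a set) set" where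
  "dual_O C = {(A, H). A \<in> seps C \<and> H \<in> halfsp C A}"

definition dual_om :: "('a set \<times> 'a set set) set \<Rightarrow> 'a set \<times> 'a set \<Rightarrow> 'a set" where
  "dual_om C e = Omega C (fst e) (snd e)"

definition dual_al :: "('a set \<times> 'a set set) set \<Rightarrow> 'a set \<times> 'a set \<Rightarrow> 'a set" where
  "dual_al C e = Omega C (fst e) (other C (fst e) (snd e))"

definition dual_rv :: "('a set \<times> 'a set set) set \<Rightarrow> 'a set \<times> 'a set \<Rightarrow> 'a set \<times> 'a set" where
  "dual_rv C e = (fst e, other C (fst e) (snd e))"

definition decomp_map ::
  "(('a set \<times> 'a) set + (nat \<Rightarrow> 'a set \<times> 'a set) set) \<Rightarrow> 'a" where
  "decomp_map p = (case p of
       Inl c \<Rightarrow> snd (SOME q. q \<in> c)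
     | Inr \<xi> \<Rightarrow> (THE x. x \<in> (\<Inter>i. snd ((SOME r. r \<in> \<xi>) i))))"

end

(*
  By noncrossing, two halfspaces with different separators are nested, disjoint, or cover K.
  Writing H for the halfspace of an oriented edge, a reduced path in the dual
  graph has strictly decreasing halfspaces, and the halfspaces of distinct edges leaving a common
  vertex are disjoint; so reduced paths are unique. Discreteness provides the paths: induct on the
  number of separators between two separators. A point outside a domain lies in the halfspace of
  exactly one edge leaving that domain. Following these edges, one either reaches a domain containing
  the point or produces a ray whose halfspaces, having diameters tending to 0 by fineness, shrink to
  it; so the map from the limit to K is bijective.

  For a finite subtree F the halfspaces of the edges leaving F are pairwise disjoint and form a null
  family, and a null family of closed sets that all meet a closed set S has closed union with S.
  This shows both that the basic sets G(U) have open images in K and that every open subset of K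
  contains enough such images.
*)

theory Submission
  imports Defs
begin

subsection \<open>Paths and rays in graphs\<close>

text \<open>Distinct separators are disjoint, so a separator determines its splitting, and every
  question of position reduces to which side of one separator contains another. The definition of a
  domain refers only to the separators adjacent to \<open>A\<close>. Minimality turns this into a
  uniform condition, namely lying in the given halfspace and on the \<open>A\<close> side of every
  other separator, and the argument works with that form throughout. Fineness bounds only the
  smaller of the two halfspaces of a splitting and does not say which one it is. To decide this, a
  fixed halfspace is placed inside the complements: the one behind the first edge of a ray, or the
  one beyond a chosen edge leaving \<open>F\<close>. Its positive diameter keeps the complements
  large. Neither compactness nor the Hausdorff property of the limit is established beforehand, so
  continuity and openness are proved separately. Both pass through \<open>trace F U\<close>, the
  subset of K that corresponds to G(U).\<close>

lemma epath_append:
  "epath al om Ed u (p @ q) v \<longleftrightarrow> (\<exists>w. epath al om Ed u p w \<and> epath al om Ed w q v)"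
  by (induction p arbitrary: u) auto

lemma reduced_tl: "reduced rv (e # p) \<Longrightarrow> reduced rv p"
  by (cases p) auto

lemma is_graphD:
  assumes "is_graph V Ed al om rv" and "e \<in> Ed"
  shows "al e \<in> V" "om e \<in> V" "rv e \<in> Ed" "rv (rv e) = e" "rv e \<noteq> e"
    "al (rv e) = om e" "om (rv e) = al e"
  using assms unfolding is_graph_def by metis+

text \<open>Prepending an edge to a reduced path creates at most one backtrack, at the join;
  deleting that pair leaves the tail of a reduced path.\<close>

lemma reduced_epath_exists:
  assumes "is_graph V Ed al om rv" and "epath al om Ed u p v"
  shows "\<exists>q. epath al om Ed u q v \<and> reduced rv q"
  using assms(2)
proof (induction p arbitrary: u)
  case Nil
  then show ?case by (intro exI[of _ "[]"]) simp
next
  case (Cons e p)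
  then have e: "e \<in> Ed" "al e = u" by auto
  from Cons obtain q where q: "epath al om Ed (om e) q v" "reduced rv q" by auto
  show ?case
  proof (cases "\<exists>q'. q = rv e # q'")
    case True
    then obtain q' where "q = rv e # q'" by blast
    then show ?thesis
      using q e is_graphD[OF assms(1) e(1)] reduced_tl[of rv "rv e" q'] by auto
  next
    case False
    then have "reduced rv (e # q)" using q by (cases q) auto
    then show ?thesis using q e by (intro exI[of _ "e # q"]) auto
  qed
qed

lemma ray_equiv_refl: "ray_equiv r r"
  unfolding ray_equiv_def by blast

lemma ray_equiv_sym: "ray_equiv r s \<Longrightarrow> ray_equiv s r"
  unfolding ray_equiv_def by metis

lemma ray_equiv_trans:
  assumes "ray_equiv r s" and "ray_equiv s t"
  shows "ray_equiv r t"
proof -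
  from assms obtain m n m' n' where *: "\<And>k. r (m + k) = s (n + k)" "\<And>k. s (m' + k) = t (n' + k)"
    unfolding ray_equiv_def by blast
  have "r ((m + m') + k) = t ((n' + n) + k)" for k
    using *(1)[of "m' + k"] *(2)[of "n + k"] by (simp add: ac_simps)
  then show ?thesis unfolding ray_equiv_def by blast
qed

lemma is_ray_Suc: "is_ray Ed al om rv r \<Longrightarrow> is_ray Ed al om rv (\<lambda>i. r (Suc i))"
  unfolding is_ray_def by auto

text \<open>Prepending an edge to a ray either extends it or cancels its first edge, and neither
  changes the end. This lets rays be compared from a common starting vertex.\<close>

lemma ray_equiv_from_vertex:
  assumes "is_graph V Ed al om rv" and "is_ray Ed al om rv r"
    and "epath al om Ed u p (al (r 0))"
  shows "\<exists>s. is_ray Ed al om rv s \<and> ray_equiv r s \<and> al (s 0) = u"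
  using assms(3)
proof (induction p arbitrary: u)
  case Nil
  then show ?case using assms(2) ray_equiv_refl by auto
next
  case (Cons e p)
  then have e: "e \<in> Ed" "al e = u" by auto
  from Cons obtain s where s: "is_ray Ed al om rv s" "ray_equiv r s" "al (s 0) = om e" by auto
  show ?case
  proof (cases "s 0 = rv e")
    case True
    have "ray_equiv s (\<lambda>i. s (Suc i))"
      unfolding ray_equiv_def by (intro exI[of _ 1] exI[of _ 0]) auto
    moreover have "al (s (Suc 0)) = u"
      using s(1) True is_graphD(7)[OF assms(1) e(1)] e unfolding is_ray_def by metis
    ultimately show ?thesis using s is_ray_Suc ray_equiv_trans by blast
  next
    case False
    let ?t = "\<lambda>i. case i of 0 \<Rightarrow> e | Suc j \<Rightarrow> s j"
    have "is_ray Ed al om rv ?t"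
      using s(1) s(3) e False unfolding is_ray_def by (auto split: nat.split)
    moreover have "ray_equiv s ?t"
      unfolding ray_equiv_def by (intro exI[of _ 0] exI[of _ 1]) auto
    ultimately show ?thesis using s e ray_equiv_trans by (intro exI[of _ ?t]) auto
  qed
qed

subsection \<open>Null families\<close>

text \<open>A point off \<open>S\<close> has positive distance from \<open>S\<close>, so small
  members, which all meet \<open>S\<close>, cannot come close to it; the finitely many large members
  form a closed set.\<close>

lemma closed_Un_null_family:
  fixes S :: "'a::metric_space set"
  assumes "closed S"
    and "\<And>i. i \<in> I \<Longrightarrow> closed (H i) \<and> bounded (H i) \<and> H i \<inter> S \<noteq> {}"
    and "\<And>\<epsilon>. \<epsilon> > 0 \<Longrightarrow> finite {i \<in> I. diameter (H i) > \<epsilon>}"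
  shows "closed (S \<union> (\<Union>i\<in>I. H i))"
proof -
  have "x \<in> S \<union> (\<Union>i\<in>I. H i)" if x: "x \<in> closure (S \<union> (\<Union>i\<in>I. H i))" for x
  proof (rule ccontr)
    assume nx: "x \<notin> S \<union> (\<Union>i\<in>I. H i)"
    then have "x \<in> - S" "open (- S)" using assms(1) by auto
    then obtain d where d: "d > 0" "ball x d \<subseteq> - S" by (meson openE)
    \<comment> \<open>With threshold \<open>d / 2\<close>, a point of a small member within
      \<open>d / 2\<close> of \<open>x\<close> leads to a point of \<open>S\<close> within
      \<open>d\<close> of \<open>x\<close>.\<close>
    let ?J = "{i \<in> I. diameter (H i) > d / 2}"
    let ?D = "\<Union>i\<in>?J. H i"
    have "finite ?J" using assms(3)[of "d / 2"] d by simp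
    then have "closed ?D" using assms(2) by (intro closed_UN) auto
    then have "open (- ?D)" by (rule open_Compl)
    moreover have "x \<in> - ?D" using nx by blast
    ultimately obtain d' where d': "d' > 0" "ball x d' \<subseteq> - ?D" by (rule openE)
    obtain y where y: "y \<in> S \<union> (\<Union>i\<in>I. H i)" "dist y x < min d' (d / 2)"
      using x d d' unfolding closure_approachable by (meson half_gt_zero min_less_iff_conj)
    then have "y \<notin> S" using d by (auto simp: dist_commute subset_eq)
    then obtain i where i: "i \<in> I" "y \<in> H i" using y by auto
    have "i \<notin> ?J" using i y d' by (auto simp: dist_commute subset_eq)
    then have di: "diameter (H i) \<le> d / 2" using i by auto
    obtain z where z: "z \<in> H i" "z \<in> S" using assms(2) i by blast
    have "dist y z \<le> d / 2" using diameter_bounded_bound[of "H i" y z] assms(2) i z di by force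
    then have "dist x z < d" using y dist_triangle[of x z y] by (simp add: dist_commute)
    then show False using d z by auto
  qed
  then show ?thesis using closure_subset_eq by blast
qed


subsection \<open>The nesting order on halfspaces\<close>

locale decomposition =
  fixes K :: "'a::metric_space set" and C :: "('a set \<times> 'a set set) set"
  assumes compact_K: "compact K" and decomp: "tree_decomposition K C"
begin

abbreviation "Ed \<equiv> dual_O C"
abbreviation "V \<equiv> dual_V C"
abbreviation "al \<equiv> dual_al C"
abbreviation "om \<equiv> dual_om C"
abbreviation "rv \<equiv> dual_rv C"

lemma splitting: "s \<in> C \<Longrightarrow> elem_splitting K s"
  using decomp unfolding tree_decomposition_def by blast

text \<open>Disjoint halfspaces have disjoint separators, since a halfspace contains its separator.
  Hence a separator determines its splitting, which justifies indexing \<open>halfsp\<close> and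
  \<open>other\<close> by the separator alone.\<close>

lemma fst_inj:
  assumes "s \<in> C" "s' \<in> C" "fst s \<inter> fst s' \<noteq> {}" shows "s = s'"
proof (rule ccontr)
  assume "s \<noteq> s'"
  then have "no_cross s s'" using decomp assms unfolding tree_decomposition_def by blast
  then obtain H H' where H: "H \<in> snd s" "H' \<in> snd s'" "H \<inter> H' = {}"
    unfolding no_cross_def by blast
  have "fst s \<subseteq> H" "fst s' \<subseteq> H'"
    using splitting[OF assms(1)] splitting[OF assms(2)] H(1,2) unfolding elem_splitting_def
    by (metis (no_types, lifting) insertE psubset_imp_subset singletonD)+
  then show False using H(3) assms(3) by blast
qed

lemma halfsp_eq:
  assumes "(A, P) \<in> C" shows "halfsp C A = P"
proof -
  have "P' = P" if "(A, P') \<in> C" for P'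
  proof -
    have "A \<noteq> {}" using splitting[OF assms] unfolding elem_splitting_def by auto
    then show ?thesis using fst_inj[OF that assms] by simp
  qed
  then show ?thesis using assms unfolding halfsp_def by blast
qed

lemma edge_cases:
  assumes "e \<in> Ed"
  obtains Z where "(fst e, {snd e, Z}) \<in> C" "elem_splitting K (fst e, {snd e, Z})"
    "Z \<noteq> snd e" "rv e = (fst e, Z)"
proof -
  obtain A H where e: "e = (A, H)" by fastforce
  with assms obtain P where P: "(A, P) \<in> C" "H \<in> P"
    unfolding dual_O_def halfsp_def by auto
  from splitting[OF P(1)] obtain Y Z where YZ: "P = {Y, Z}" "Y \<inter> Z = A" "A \<subset> Y" "A \<subset> Z"
    unfolding elem_splitting_def by auto
  \<comment> \<open>The two halfspaces differ because A is their intersection and proper in both;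
    \<open>other\<close> therefore denotes a unique set.\<close>
  define Z' where "Z' = (if H = Y then Z else Y)"
  have Z': "P = {H, Z'}" "Z' \<noteq> H" using YZ P(2) unfolding Z'_def by auto
  have "other C A H = Z'"
    unfolding other_def halfsp_eq[OF P(1)] using Z' by (intro the_equality) auto
  then show thesis using that[of Z'] e P(1) Z' splitting[OF P(1)] unfolding dual_rv_def by simp
qed

lemma
  assumes "e \<in> Ed"
  shows rv_in: "rv e \<in> Ed" and rv_rv: "rv (rv e) = e" and rv_ne: "rv e \<noteq> e"
    and fst_rv: "fst (rv e) = fst e"
    and half_Un: "snd e \<union> snd (rv e) = K" and half_Int: "snd e \<inter> snd (rv e) = fst e"
    and sep_ne: "fst e \<noteq> {}" and sep_psubset: "fst e \<subset> snd e" 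
    and compact_half: "compact (snd e)" and compact_sep: "compact (fst e)"
    and edge_in_C: "(fst e, {snd e, snd (rv e)}) \<in> C"
proof -
  from edge_cases[OF assms] obtain Z where Z: "(fst e, {snd e, Z}) \<in> C"
    "elem_splitting K (fst e, {snd e, Z})" "Z \<noteq> snd e" "rv e = (fst e, Z)" .
  show *: "rv e \<in> Ed" using Z unfolding dual_O_def seps_def halfsp_def by force
  show "fst (rv e) = fst e" "rv e \<noteq> e" using Z by (auto simp: prod_eq_iff)
  have "other C (fst e) Z = snd e"
    unfolding other_def halfsp_eq[OF Z(1)] using Z(3) by (intro the_equality) auto
  then show "rv (rv e) = e" unfolding Z(4) unfolding dual_rv_def by simp
  show "snd e \<union> snd (rv e) = K" "snd e \<inter> snd (rv e) = fst e" "fst e \<noteq> {}" "fst e \<subset> snd e"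
    "compact (snd e)" "compact (fst e)" "(fst e, {snd e, snd (rv e)}) \<in> C"
    using Z unfolding elem_splitting_def by (auto simp: doubleton_eq_iff)
qed

lemma sep_subset: "e \<in> Ed \<Longrightarrow> fst e \<subseteq> snd e"
  using sep_psubset by blast

lemma half_subset: "e \<in> Ed \<Longrightarrow> snd e \<subseteq> K"
  using half_Un by blast

lemma edge_same_sep:
  assumes "e \<in> Ed" "f \<in> Ed" "fst f = fst e" shows "f = e \<or> f = rv e"
proof -
  have "snd f \<in> halfsp C (fst e)" using assms unfolding dual_O_def by force
  then have "snd f \<in> {snd e, snd (rv e)}" using halfsp_eq[OF edge_in_C[OF assms(1)]] by simp
  then show ?thesis using assms fst_rv[OF assms(1)] by (auto simp: prod_eq_iff)
qed

lemma ex_edge: "A \<in> seps C \<Longrightarrow> \<exists>e\<in>Ed. fst e = A"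
proof -
  assume A: "A \<in> seps C"
  then obtain P where P: "(A, P) \<in> C" unfolding seps_def by auto
  from splitting[OF this] obtain H where "H \<in> P" unfolding elem_splitting_def by auto
  then have "(A, H) \<in> Ed" using A P unfolding dual_O_def halfsp_def by auto
  then show ?thesis by force
qed

lemma edge_sep: "e \<in> Ed \<Longrightarrow> fst e \<in> seps C"
  unfolding dual_O_def by auto

lemma halfsp_iff: "J \<in> halfsp C A \<longleftrightarrow> (A, J) \<in> Ed"
  unfolding dual_O_def seps_def halfsp_def by force

lemma sep_disjoint:
  assumes "e \<in> Ed" "f \<in> Ed" "fst e \<noteq> fst f" shows "fst e \<inter> fst f = {}"
  using fst_inj[OF edge_in_C[OF assms(1)] edge_in_C[OF assms(2)]] assms(3) by auto

lemma not_crossing: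
  assumes "e \<in> Ed" "f \<in> Ed" "fst e \<noteq> fst f"
  shows "snd e \<inter> snd f = {} \<or> snd (rv e) \<inter> snd f = {} \<or> snd e \<inter> snd (rv f) = {}
    \<or> snd (rv e) \<inter> snd (rv f) = {}"
proof -
  have "no_cross (fst e, {snd e, snd (rv e)}) (fst f, {snd f, snd (rv f)})"
    using decomp edge_in_C[OF assms(1)] edge_in_C[OF assms(2)] assms(3)
    unfolding tree_decomposition_def by blast
  then show ?thesis unfolding no_cross_def by auto
qed

lemma sep_subset_rv: "e \<in> Ed \<Longrightarrow> fst e \<subseteq> snd (rv e)"
  using sep_subset[OF rv_in] fst_rv by simp

text \<open>Some halfspace of \<open>e\<close> misses some halfspace of \<open>f\<close>; it
  contains \<open>fst e\<close>, which forces \<open>fst e\<close> to the other side of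
  \<open>f\<close>.\<close>

lemma sep_side:
  assumes "e \<in> Ed" "f \<in> Ed" "fst e \<noteq> fst f"
  shows "fst e \<subseteq> snd f \<or> fst e \<subseteq> snd (rv f)"
  using not_crossing[OF assms] sep_subset[OF assms(1)] sep_subset_rv[OF assms(1)]
    half_Un[OF assms(2)] half_subset[OF assms(1)] by blast

text \<open>Any other alternative of \<open>not_crossing\<close> would put a nonempty separator into
  two disjoint halfspaces.\<close>

lemma halves_disjoint:
  assumes "e \<in> Ed" "f \<in> Ed" "fst e \<noteq> fst f" "fst e \<subseteq> snd (rv f)" "fst f \<subseteq> snd (rv e)"
  shows "snd e \<inter> snd f = {}"
  using not_crossing[OF assms(1-3)] sep_subset[OF assms(1)] sep_subset_rv[OF assms(1)]
    sep_subset[OF assms(2)] sep_subset_rv[OF assms(2)] sep_ne[OF assms(1)] sep_ne[OF assms(2)]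
    assms(4,5) by blast

lemma halves_nested:
  assumes "e \<in> Ed" "f \<in> Ed" "fst e \<noteq> fst f" "fst f \<subseteq> snd e" "fst e \<subseteq> snd (rv f)"
  shows "snd f \<subseteq> snd e - fst e"
proof -
  have "snd (rv e) \<inter> snd f = {}"
    using halves_disjoint[of "rv e" f] assms rv_in fst_rv rv_rv by simp
  then show ?thesis using half_Un[OF assms(1)] half_Int[OF assms(1)] half_subset[OF assms(2)] by blast
qed

text \<open>Discreteness makes this set finite; its cardinality is the measure for the inductions
  below.\<close>

definition between :: "'a set \<Rightarrow> 'a set \<Rightarrow> 'a set set" where
  "between A B = {D \<in> seps C. separates C D A B}"

lemma finite_between: "A \<in> seps C \<Longrightarrow> B \<in> seps C \<Longrightarrow> finite (between A B)"
  using decomp unfolding between_def tree_decomposition_def by blast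

text \<open>Replaces \<open>other\<close> and the choice of a halfspace by one edge \<open>d\<close>
  directed from \<open>A\<close> towards \<open>B\<close>.\<close>

lemma separates_iff:
  "separates C D A B \<longleftrightarrow> (\<exists>d\<in>Ed. fst d = D \<and> A \<subseteq> snd (rv d) - D \<and> B \<subseteq> snd d - D)"
proof
  assume "separates C D A B"
  then obtain J where J: "(D, J) \<in> Ed" "A \<subseteq> J - D" "B \<subseteq> other C D J - D"
    unfolding separates_def Bex_def halfsp_iff by blast
  then show "\<exists>d\<in>Ed. fst d = D \<and> A \<subseteq> snd (rv d) - D \<and> B \<subseteq> snd d - D"
    using rv_in[OF J(1)] rv_rv[OF J(1)] by (intro bexI[of _ "rv (D, J)"]) (auto simp: dual_rv_def)
next
  assume "\<exists>d\<in>Ed. fst d = D \<and> A \<subseteq> snd (rv d) - D \<and> B \<subseteq> snd d - D"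
  then obtain d where d: "d \<in> Ed" "fst d = D" "A \<subseteq> snd (rv d) - D" "B \<subseteq> snd d - D" by blast
  have "rv d = (D, snd (rv d))" using fst_rv[OF d(1)] d(2) by (auto simp: prod_eq_iff)
  moreover have "other C D (snd (rv d)) = snd d"
    using arg_cong[OF rv_rv[OF d(1)], of snd] d(2) unfolding dual_rv_def by simp
  ultimately have "snd (rv d) \<in> halfsp C D"
    "A \<subseteq> snd (rv d) - D \<and> B \<subseteq> other C D (snd (rv d)) - D"
    unfolding halfsp_iff using d rv_in[OF d(1)] by auto
  then show "separates C D A B" unfolding separates_def by blast
qed

text \<open>Both \<open>d\<close> and \<open>f\<close> point away from \<open>e\<close>. If
  \<open>fst d\<close> lay in \<open>snd f\<close>, the near sides of \<open>d\<close> and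
  \<open>f\<close> would be disjoint although both contain \<open>fst e\<close>.\<close>

lemma separating_nested:
  assumes "e \<in> Ed" "d \<in> Ed" "f \<in> Ed" "fst e \<subseteq> snd (rv d) - fst d" "fst f \<subseteq> snd d - fst d"
    "fst e \<subseteq> snd (rv f) - fst f"
  shows "snd f \<subseteq> snd d - fst d"
proof (rule halves_nested[OF assms(2,3)])
  show ne: "fst d \<noteq> fst f" using assms(5) sep_ne[OF assms(3)] by blast
  show "fst f \<subseteq> snd d" using assms(5) by blast
  show "fst d \<subseteq> snd (rv f)"
  proof (rule ccontr)
    assume "\<not> fst d \<subseteq> snd (rv f)"
    then have "fst d \<subseteq> snd f" using sep_side[OF assms(2,3) ne] by blast
    then have "snd (rv d) \<inter> snd (rv f) = {}"
      using halves_disjoint[of "rv d" "rv f"] assms rv_in fst_rv rv_rv ne by auto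
    then show False using assms(4,6) sep_ne[OF assms(1)] by blast
  qed
qed

text \<open>By nesting, a separator between \<open>fst e\<close> and \<open>D\<close> also has
  \<open>fst f\<close> on its far side, while \<open>D\<close> does not separate
  \<open>fst e\<close> from \<open>D\<close> itself.\<close>

lemma between_smaller:
  assumes "e \<in> Ed" "f \<in> Ed" "D \<in> between (fst e) (fst f)"
    "fst e \<inter> fst f = {}"
  shows "card (between (fst e) D) < card (between (fst e) (fst f))"
proof -
  from assms(3) obtain d where d: "d \<in> Ed" "fst d = D" "fst e \<subseteq> snd (rv d) - D" "fst f \<subseteq> snd d - D"
    unfolding between_def separates_iff by blast
  have "between (fst e) D \<subseteq> between (fst e) (fst f)"
  proof
    fix G assume "G \<in> between (fst e) D"
    then obtain g where g: "g \<in> Ed" "fst g = G" "fst e \<subseteq> snd (rv g) - G" "D \<subseteq> snd g - G"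
      unfolding between_def separates_iff by blast
    have "snd d \<subseteq> snd g - fst g"
      using separating_nested[OF assms(1) g(1) d(1)] g d by auto
    then show "G \<in> between (fst e) (fst f)"
      unfolding between_def separates_iff using g d edge_sep by blast
  qed
  moreover have "D \<notin> between (fst e) D"
    unfolding between_def separates_iff using sep_ne d by blast
  ultimately have "between (fst e) D \<subset> between (fst e) (fst f)" using assms(3) by blast
  then show ?thesis
    using finite_between[OF edge_sep[OF assms(1)] edge_sep[OF assms(2)]] by (rule psubset_card_mono[rotated])
qed

lemma between_commute: "between A B = between B A"
proof -
  have "separates C D B A" if "separates C D A B" for A B D
  proof -
    from that obtain d where "d \<in> Ed" "fst d = D" "A \<subseteq> snd (rv d) - D" "B \<subseteq> snd d - D"
      unfolding separates_iff by blast
    then show ?thesis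
      unfolding separates_iff using rv_in rv_rv fst_rv by (intro bexI[of _ "rv d"]) auto
  qed
  then show ?thesis unfolding between_def by blast
qed

text \<open>A separator between \<open>fst e\<close> and \<open>fst f\<close> still has
  \<open>x\<close> on its far side and has fewer separators before it. The one reached at the end
  meets the requirement in \<open>Lam\<close> that nothing separates it from
  \<open>fst e\<close>.\<close>

lemma minimal_separator:
  assumes "e \<in> Ed" "f \<in> Ed" "fst f \<noteq> fst e" "fst e \<subseteq> snd (rv f)" "x \<in> snd f - fst f"
  shows "\<exists>d\<in>Ed. fst d \<noteq> fst e \<and> fst e \<subseteq> snd (rv d) \<and> x \<in> snd d - fst d \<and> between (fst e) (fst d) = {}"
  using assms(2-5)
proof (induction "card (between (fst e) (fst f))" arbitrary: f rule: less_induct)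
  case less
  show ?case
  proof (cases "between (fst e) (fst f) = {}")
    case True
    then show ?thesis using less by blast
  next
    case False
    then obtain D where D: "D \<in> between (fst e) (fst f)" by blast
    then obtain d where d: "d \<in> Ed" "fst d = D" "fst e \<subseteq> snd (rv d) - D" "fst f \<subseteq> snd d - D"
      unfolding between_def separates_iff by blast
    have dj: "fst e \<inter> fst f = {}" using sep_disjoint less.prems assms(1) by metis
    have "snd f \<subseteq> snd d - fst d"
      using separating_nested[OF assms(1) d(1) less.prems(1)] d less.prems dj by auto
    then show ?thesis
      using less.hyps[of d] between_smaller[OF assms(1) less.prems(1) D dj] d less.prems(4) sep_ne[OF d(1)]
      by auto
  qed
qed


subsection \<open>Domains\<close>

lemma hs_containing_unique:
  assumes "e \<in> Ed" "f \<in> Ed" "fst e \<noteq> fst f" "fst e \<subseteq> snd f"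
  shows "hs_containing C (fst e) (fst f) = snd f"
  unfolding hs_containing_def
proof (rule the_equality)
  show "snd f \<in> halfsp C (fst f) \<and> fst e \<subseteq> snd f" using assms halfsp_iff by auto
next
  fix J assume J: "J \<in> halfsp C (fst f) \<and> fst e \<subseteq> J"
  then have "(fst f, J) = f \<or> (fst f, J) = rv f"
    using edge_same_sep[OF assms(2), of "(fst f, J)"] halfsp_iff by auto
  moreover have "\<not> fst e \<subseteq> snd (rv f)"
    using half_Int[OF assms(2)] sep_disjoint[OF assms(1-3)] sep_ne[OF assms(1)] assms(4) by blast
  ultimately show "J = snd f" using J by (metis snd_conv)
qed

lemma minimal_excluding_separator:
  assumes "e \<in> Ed" "f \<in> Ed" "fst f \<noteq> fst e" "fst e \<subseteq> snd f" "x \<in> K" "x \<notin> snd f"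
  obtains d where "d \<in> Ed" "fst d \<noteq> fst e" "fst e \<subseteq> snd (rv d)" "x \<in> snd d - fst d"
    "between (fst e) (fst d) = {}"
proof -
  have "x \<in> snd (rv f) - fst (rv f)"
    using half_Un[OF assms(2)] half_Int[OF assms(2)] assms(5,6) fst_rv[OF assms(2)] by blast
  moreover have "fst (rv f) \<noteq> fst e" "fst e \<subseteq> snd (rv (rv f))"
    using assms(3,4) fst_rv[OF assms(2)] rv_rv[OF assms(2)] by simp_all
  ultimately show thesis
    using minimal_separator[OF assms(1) rv_in[OF assms(2)]] that by blast
qed

text \<open>The constraint from an arbitrary separator already follows from those in \<^const>\<open>Lam\<close>,
  by minimality.\<close>

lemma mem_om_iff:
  assumes "e \<in> Ed"
  shows "x \<in> om e \<longleftrightarrow> x \<in> snd e \<and> (\<forall>f\<in>Ed. fst f \<noteq> fst e \<longrightarrow> fst e \<subseteq> snd f \<longrightarrow> x \<in> snd f)"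
    (is "_ \<longleftrightarrow> ?R")
proof
  assume x: "x \<in> om e"
  then have xe: "x \<in> snd e" unfolding dual_om_def Omega_def by blast
  moreover have "x \<in> snd f" if f: "f \<in> Ed" "fst f \<noteq> fst e" "fst e \<subseteq> snd f" for f
  proof (rule ccontr)
    assume "x \<notin> snd f"
    then obtain d where d: "d \<in> Ed" "fst d \<noteq> fst e" "fst e \<subseteq> snd (rv d)" "x \<in> snd d - fst d"
      "between (fst e) (fst d) = {}"
      using minimal_excluding_separator[OF assms f] half_subset[OF assms] xe by blast
    have hs: "hs_containing C (fst e) (fst d) = snd (rv d)"
      using hs_containing_unique[OF assms rv_in[OF d(1)]] d fst_rv[OF d(1)] by auto
    have nx: "x \<notin> snd (rv d)" using d half_Int by blast
    then have "fst d \<in> Lam C (fst e) (snd e)"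
      using hs d xe edge_sep unfolding Lam_def between_def by auto
    then have "x \<in> snd (rv d)" using x hs unfolding dual_om_def Omega_def by auto
    then show False using nx by blast
  qed
  ultimately show ?R by blast
next
  assume R: ?R
  have "x \<in> hs_containing C (fst e) D" if "D \<in> Lam C (fst e) (snd e)" for D
  proof -
    from that have D: "D \<in> seps C" "D \<noteq> fst e" unfolding Lam_def by auto
    then obtain d where d: "d \<in> Ed" "fst d = D" using ex_edge by blast
    have "\<exists>d\<in>Ed. fst d = D \<and> fst e \<subseteq> snd d"
      using sep_side[OF assms d(1)] d D rv_in fst_rv by metis
    then show ?thesis using R D hs_containing_unique[OF assms] by metis
  qed
  then show "x \<in> om e" using R unfolding dual_om_def Omega_def by blast
qed

lemma al_eq: "al e = om (rv e)"
  unfolding dual_al_def dual_om_def dual_rv_def by simp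

lemma om_rv: "e \<in> Ed \<Longrightarrow> om (rv e) = al e"
  by (simp add: al_eq)

lemma al_rv: "e \<in> Ed \<Longrightarrow> al (rv e) = om e"
  by (simp add: al_eq rv_rv)

lemma V_iff: "u \<in> V \<longleftrightarrow> (\<exists>e\<in>Ed. u = om e)"
  unfolding dual_V_def dual_O_def dual_om_def halfsp_def by force

lemma om_in_V: "e \<in> Ed \<Longrightarrow> om e \<in> V" and al_in_V: "e \<in> Ed \<Longrightarrow> al e \<in> V"
  unfolding V_iff using rv_in al_eq by metis+

lemma om_subset: "e \<in> Ed \<Longrightarrow> om e \<subseteq> snd e"
  using mem_om_iff by blast

lemma al_subset: "e \<in> Ed \<Longrightarrow> al e \<subseteq> snd (rv e)"
  using om_subset[OF rv_in] al_eq by metis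

lemma sep_subset_om: "e \<in> Ed \<Longrightarrow> fst e \<subseteq> om e"
  using mem_om_iff sep_subset by blast

lemma sep_subset_al: "e \<in> Ed \<Longrightarrow> fst e \<subseteq> al e"
  using sep_subset_om[OF rv_in] al_eq fst_rv by metis

text \<open>An edge ending at \<open>u\<close> decides the side: the domain lies where that edge's
  separator lies, or in the edge's own halfspace if the separators agree.\<close>

lemma vertex_side:
  assumes "u \<in> V" "f \<in> Ed" shows "u \<subseteq> snd f \<or> u \<subseteq> snd (rv f)"
proof -
  from assms(1) obtain e where e: "e \<in> Ed" "u = om e" using V_iff by blast
  show ?thesis
  proof (cases "fst e = fst f")
    case True
    then show ?thesis using edge_same_sep[OF assms(2) e(1)] om_subset[OF e(1)] e(2) by auto
  next
    case False
    then show ?thesis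
      using sep_side[OF e(1) assms(2)] mem_om_iff[OF e(1)] e(2) assms(2) rv_in[OF assms(2)] fst_rv[OF assms(2)]
      by (metis subsetI)
  qed
qed

lemma vertex_subset: "u \<in> V \<Longrightarrow> u \<subseteq> K"
  unfolding V_iff using om_subset half_subset by (metis subset_trans)

lemma vertex_nonempty: "u \<in> V \<Longrightarrow> u \<noteq> {}"
  unfolding V_iff using sep_subset_om sep_ne by (metis subset_empty)

lemma compact_vertex:
  assumes "u \<in> V" shows "compact u"
proof -
  from assms obtain e where e: "e \<in> Ed" "u = om e" using V_iff by blast
  have "u = snd e \<inter> (\<Inter>f\<in>{f\<in>Ed. fst f \<noteq> fst e \<and> fst e \<subseteq> snd f}. snd f)"
    using mem_om_iff[OF e(1)] e(2) by blast
  moreover have "closed (\<Inter>f\<in>{f\<in>Ed. fst f \<noteq> fst e \<and> fst e \<subseteq> snd f}. snd f)"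
    using compact_half compact_imp_closed by (intro closed_INT) blast
  ultimately show ?thesis using compact_half[OF e(1)] by (simp add: compact_Int_closed)
qed

text \<open>The two halfspaces face each other. A condition imposed on one domain but not on the
  other would come from a separator lying between the two.\<close>

lemma om_eq_om:
  assumes "e \<in> Ed" "f \<in> Ed" "fst e \<noteq> fst f" "fst f \<subseteq> snd e" "fst e \<subseteq> snd f"
    "between (fst e) (fst f) = {}"
  shows "om e = om f"
proof -
  have *: "om e \<subseteq> om f"
    if ef: "e \<in> Ed" "f \<in> Ed" "fst e \<noteq> fst f" "fst f \<subseteq> snd e" "fst e \<subseteq> snd f"
      "between (fst f) (fst e) = {}" for e f
  proof
    fix x assume x: "x \<in> om e"
    have "x \<in> snd g" if g: "g \<in> Ed" "fst g \<noteq> fst f" "fst f \<subseteq> snd g" for g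
    proof (cases "fst g = fst e")
      case True
      have dj: "fst f \<inter> fst e = {}" "fst f \<noteq> {}" using sep_disjoint[OF ef(2,1)] ef sep_ne by auto
      have "g \<noteq> rv e" using g(3) ef(4) half_Int[OF ef(1)] dj by blast
      then have "g = e" using edge_same_sep[OF ef(1) g(1) True] by blast
      then show ?thesis using x om_subset ef by blast
    next
      case False
      have "fst e \<subseteq> snd g"
      proof (rule ccontr)
        assume "\<not> fst e \<subseteq> snd g"
        then have "fst e \<subseteq> snd (rv g)" using sep_side[OF ef(1) g(1)] False by auto
        then have "fst e \<subseteq> snd (rv g) - fst g" "fst f \<subseteq> snd g - fst g"
          using sep_disjoint[OF ef(1) g(1)] sep_disjoint[OF ef(2) g(1)] False g by auto
        then have "separates C (fst g) (fst e) (fst f)" unfolding separates_iff using g by blast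
        then show False using ef(6) between_commute edge_sep[OF g(1)] unfolding between_def by blast
      qed
      then show ?thesis using x mem_om_iff[OF ef(1)] g False by blast
    qed
    moreover have "x \<in> snd f" using x mem_om_iff[OF ef(1)] ef by metis
    ultimately show "x \<in> om f" using mem_om_iff[OF ef(2)] by blast
  qed
  show ?thesis using *[of e f] *[of f e] assms between_commute by (metis subset_antisym)
qed

text \<open>An edge that cuts \<open>x\<close> off from \<open>fst e\<close>, with no separator in
  between, faces away from the same domain that \<open>e\<close> enters.\<close>

lemma exit_edge_aux:
  assumes "e \<in> Ed" "x \<in> snd e" "x \<notin> om e"
  shows "\<exists>d\<in>Ed. fst d \<noteq> fst e \<and> al d = om e \<and> x \<in> snd d - fst d"
proof -
  obtain f where f: "f \<in> Ed" "fst f \<noteq> fst e" "fst e \<subseteq> snd f" "x \<notin> snd f"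
    using assms mem_om_iff by blast
  obtain d where d: "d \<in> Ed" "fst d \<noteq> fst e" "fst e \<subseteq> snd (rv d)" "x \<in> snd d - fst d"
    "between (fst e) (fst d) = {}"
    using minimal_excluding_separator[OF assms(1) f(1-3) _ f(4)] half_subset[OF assms(1)] assms(2) by blast
  \<comment> \<open>Otherwise the halfspaces of \<open>d\<close> and \<open>e\<close> would be
    disjoint, but both contain \<open>x\<close>.\<close>
  have "fst d \<subseteq> snd e"
  proof (rule ccontr)
    assume "\<not> fst d \<subseteq> snd e"
    then have "fst d \<subseteq> snd (rv e)" using sep_side[OF d(1) assms(1) d(2)] by blast
    then have "snd d \<inter> snd e = {}" using halves_disjoint[OF d(1) assms(1) d(2)] d(3) by blast
    then show False using d assms by blast
  qed
  then have "om e = om (rv d)"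
    using om_eq_om[OF assms(1) rv_in[OF d(1)]] d fst_rv[OF d(1)] by auto
  then show ?thesis using d al_eq by metis
qed

lemma exit_edge:
  assumes "u \<in> V" "x \<in> K" "x \<notin> u"
  shows "\<exists>d\<in>Ed. al d = u \<and> x \<in> snd d - fst d"
proof -
  from assms(1) obtain e where e: "e \<in> Ed" "u = om e" using V_iff by blast
  show ?thesis
  proof (cases "x \<in> snd e")
    case True
    then show ?thesis using exit_edge_aux[OF e(1) True] assms e by blast
  next
    case False
    then have "x \<in> snd (rv e) - fst (rv e)"
      using half_Un[OF e(1)] half_Int[OF e(1)] assms(2) fst_rv[OF e(1)] by blast
    then show ?thesis using e rv_in al_rv by metis
  qed
qed

text \<open>Otherwise the exit edge towards a point of the halfspace off the separator would have
  its own separator inside \<open>fst e\<close>, contradicting disjointness.\<close>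

lemma om_not_subset_sep:
  assumes "e \<in> Ed" shows "\<not> om e \<subseteq> fst e"
proof
  assume *: "om e \<subseteq> fst e"
  obtain x where x: "x \<in> snd e" "x \<notin> fst e" using sep_psubset[OF assms] by blast
  then obtain d where d: "d \<in> Ed" "fst d \<noteq> fst e" "al d = om e"
    using exit_edge_aux[OF assms, of x] * by blast
  then have "fst d \<subseteq> fst e" using sep_subset_al[OF d(1)] * by blast
  then show False using sep_disjoint[OF d(1) assms d(2)] sep_ne[OF d(1)] by blast
qed

text \<open>Such a \<open>u\<close> lies in \<open>fst e\<close>, so an edge ending at
  \<open>u\<close> has the same separator, and the domain would be contained in that
  separator.\<close>

lemma vertex_not_both_sides:
  assumes "u \<in> V" "e \<in> Ed" "u \<subseteq> snd e" "u \<subseteq> snd (rv e)" shows False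
proof -
  from assms(1) obtain f where f: "f \<in> Ed" "u = om f" using V_iff by blast
  have "u \<subseteq> fst e" using assms half_Int by blast
  moreover have "fst f \<subseteq> u" using sep_subset_om f by blast
  ultimately show False
    using om_not_subset_sep[OF f(1)] sep_disjoint[OF f(1) assms(2)] sep_ne[OF f(1)] f(2) by force
qed

subsection \<open>The dual tree\<close>

lemma graph: "is_graph V Ed al om rv"
  unfolding is_graph_def using al_in_V om_in_V rv_in rv_rv rv_ne al_rv by blast

lemma consecutive_nested:
  assumes "e \<in> Ed" "f \<in> Ed" "al f = om e" "f \<noteq> rv e"
  shows "fst e \<noteq> fst f" "snd f \<subseteq> snd e - fst e"
proof -
  show ne: "fst e \<noteq> fst f"
  proof
    assume "fst e = fst f"
    \<comment> \<open>A repeated edge would have equal end vertices, putting one domain on both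
      sides of a separator.\<close>
    then have "f = e" using edge_same_sep[OF assms(1,2)] assms(4) by auto
    then have "om e \<subseteq> snd e" "om e \<subseteq> snd (rv e)"
      using om_subset[OF assms(1)] al_subset[OF assms(1)] assms(3) by auto
    then show False using vertex_not_both_sides om_in_V assms(1) by blast
  qed
  have "fst f \<subseteq> snd e" "fst e \<subseteq> snd (rv f)"
    using sep_subset_al[OF assms(2)] om_subset[OF assms(1)] sep_subset_om[OF assms(1)]
      al_subset[OF assms(2)] assms(3) by auto
  then show "snd f \<subseteq> snd e - fst e" using halves_nested[OF assms(1,2) ne] by blast
qed

text \<open>The edges \<open>rv e\<close> and \<open>f\<close> are consecutive without backtracking,
  so \<open>snd f\<close> is nested in \<open>snd (rv e)\<close> off the separator, away from
  \<open>snd e\<close>.\<close>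

lemma outgoing_disjoint:
  assumes "e \<in> Ed" "f \<in> Ed" "al e = al f" "e \<noteq> f"
  shows "fst e \<noteq> fst f" "snd e \<inter> snd f = {}"
proof -
  have *: "fst (rv e) \<noteq> fst f" "snd f \<subseteq> snd (rv e) - fst (rv e)"
    using consecutive_nested[OF rv_in[OF assms(1)] assms(2)] assms om_rv rv_rv by auto
  then show "fst e \<noteq> fst f" "snd e \<inter> snd f = {}"
    using fst_rv[OF assms(1)] half_Int[OF assms(1)] by auto
qed

lemma reduced_path_nested:
  assumes "epath al om Ed u (e # p) v" "reduced rv (e # p)"
  shows "v \<subseteq> snd e" "f \<in> set p \<Longrightarrow> snd f \<subseteq> snd e - fst e"
proof -
  have "v \<subseteq> snd e \<and> (\<forall>f\<in>set p. snd f \<subseteq> snd e - fst e)" using assms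
  proof (induction p arbitrary: u e)
    case Nil
    then show ?case using om_subset[of e] by auto
  next
    case (Cons f p)
    then have "snd f \<subseteq> snd e - fst e" using consecutive_nested[of e f] by auto
    moreover have "v \<subseteq> snd f \<and> (\<forall>g\<in>set p. snd g \<subseteq> snd f - fst f)" using Cons by auto
    ultimately show ?case by auto
  qed
  then show "v \<subseteq> snd e" "f \<in> set p \<Longrightarrow> snd f \<subseteq> snd e - fst e" by auto
qed

text \<open>The path ends inside \<open>snd e\<close> but starts on the opposite side.\<close>

lemma reduced_path_ne:
  assumes "epath al om Ed u (e # p) v" "reduced rv (e # p)" shows "u \<noteq> v"
proof -
  have "v \<subseteq> snd e" "u \<subseteq> snd (rv e)" "e \<in> Ed" "u \<in> V"
    using reduced_path_nested(1)[OF assms] assms(1) al_subset[of e] al_in_V[of e] by auto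
  then show ?thesis using vertex_not_both_sides by blast
qed

lemma reduced_path_unique:
  assumes "epath al om Ed u p v" "reduced rv p" "epath al om Ed u q v" "reduced rv q" "v \<in> V"
  shows "p = q"
  using assms
proof (induction p arbitrary: u q)
  case Nil
  then show ?case using reduced_path_ne[of u] by (cases q) auto
next
  case (Cons e p)
  obtain f q' where q: "q = f # q'" using Cons.prems reduced_path_ne[of u] by (cases q) auto
  have "v \<subseteq> snd e" "v \<subseteq> snd f" using reduced_path_nested(1) Cons.prems q by blast+
  then have "snd e \<inter> snd f \<noteq> {}" using vertex_nonempty[OF assms(5)] by blast
  then have "e = f" using outgoing_disjoint[of e f] Cons.prems q by auto
  moreover have "p = q'"
    using Cons.IH[of "om e" q'] Cons.prems q \<open>e = f\<close> reduced_tl by (metis epath.simps(2))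
  ultimately show ?case using q by blast
qed

section \<open>Connectedness of the dual graph\<close>

definition connected_vertices :: "'a set \<Rightarrow> 'a set \<Rightarrow> bool" where
  "connected_vertices u v \<longleftrightarrow> (\<exists>p. epath al om Ed u p v)"

lemma connected_vertices_trans:
  "connected_vertices u v \<Longrightarrow> connected_vertices v w \<Longrightarrow> connected_vertices u w"
  unfolding connected_vertices_def using epath_append by metis

lemma connected_edge: "e \<in> Ed \<Longrightarrow> connected_vertices (al e) (om e)"
  unfolding connected_vertices_def by (intro exI[of _ "[e]"]) simp

lemma connected_same_sep:
  assumes "e \<in> Ed" "f \<in> Ed" "fst f = fst e" shows "connected_vertices (om e) (om f)"
proof -
  have "connected_vertices (om e) (om e)"
    unfolding connected_vertices_def by (intro exI[of _ "[]"]) simp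
  moreover have "connected_vertices (om e) (om (rv e))"
    using connected_edge[OF rv_in[OF assms(1)]] al_rv assms(1) by simp
  ultimately show ?thesis using edge_same_sep[OF assms] by auto
qed

lemma vertices_connected:
  assumes "e \<in> Ed" "f \<in> Ed" shows "connected_vertices (om e) (om f)"
  using assms
proof (induction "card (between (fst e) (fst f))" arbitrary: e f rule: less_induct)
  case less
  show ?case
  proof (cases "fst f = fst e")
    case True
    then show ?thesis using connected_same_sep less.prems by blast
  next
    case False
    then have dj: "fst e \<inter> fst f = {}" using sep_disjoint less.prems by metis
    show ?thesis
    proof (cases "between (fst e) (fst f) = {}")
      case True
      \<comment> \<open>Turned to face each other, the two edges end at one common domain; turning
        an edge around only moves to a neighbouring vertex.\<close>
      obtain e' where e': "e' \<in> Ed" "fst e' = fst e" "fst f \<subseteq> snd e'"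
        using sep_side[OF less.prems(2,1) False] less.prems rv_in fst_rv by metis
      obtain f' where f': "f' \<in> Ed" "fst f' = fst f" "fst e \<subseteq> snd f'"
        using sep_side[OF less.prems] False less.prems rv_in fst_rv by metis
      have "om e' = om f'" using om_eq_om[OF e'(1) f'(1)] e' f' False True by auto
      then show ?thesis
        using connected_same_sep[OF less.prems(1) e'(1,2)] connected_same_sep[OF f'(1) less.prems(2)]
          f'(2) connected_vertices_trans by auto
    next
      case False
      then obtain D where D: "D \<in> between (fst e) (fst f)" by blast
      then obtain d where d: "d \<in> Ed" "fst d = D" using ex_edge unfolding between_def by blast
      have "connected_vertices (om e) (om d)"
        using less.hyps[OF _ less.prems(1) d(1)] between_smaller[OF less.prems D dj] d by auto
      \<comment> \<open>The measure drops on this half too, since \<open>between\<close> is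
        symmetric.\<close>
      moreover have "connected_vertices (om d) (om f)"
        using less.hyps[OF _ d(1) less.prems(2)] between_smaller[OF less.prems(2,1), of D] D dj d
          between_commute by (metis inf_commute)
      ultimately show ?thesis using connected_vertices_trans by blast
    qed
  qed
qed

lemma epath_exists: "u \<in> V \<Longrightarrow> v \<in> V \<Longrightarrow> \<exists>p. epath al om Ed u p v"
  using vertices_connected unfolding V_iff connected_vertices_def by metis

lemma tree: "is_tree V Ed al om rv"
  unfolding is_tree_def
proof (intro conjI ballI graph)
  fix u v assume "u \<in> V" "v \<in> V"
  then obtain p where "epath al om Ed u p v" "reduced rv p"
    using reduced_epath_exists[OF graph] epath_exists by blast
  then show "\<exists>!p. epath al om Ed u p v \<and> reduced rv p"
    using reduced_path_unique \<open>v \<in> V\<close> by (intro ex1I[of _ p]) blast+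
qed

lemma tree_path:
  assumes "u \<in> V" "v \<in> V" obtains p where "epath al om Ed u p v" "reduced rv p"
  using assms reduced_epath_exists[OF graph] epath_exists by blast

end


section \<open>Consequences of fineness and the associated tree system\<close>

lemma diameter_bound:
  fixes S :: "'a::metric_space set"
  shows "compact S \<Longrightarrow> x \<in> S \<Longrightarrow> y \<in> S \<Longrightarrow> dist x y \<le> diameter S"
  using diameter_bounded_bound compact_imp_bounded by blast

text \<open>Domains are indexed by separators, so with no splitting there would be no vertices and
  the limit would be empty, whatever K is.\<close>

locale fine_tree_decomposition = decomposition +
  assumes fine: "fine_decomposition C" and nonempty: "C \<noteq> {}"
begin

lemma finite_large_edges:
  assumes "\<epsilon> > 0"
  shows "finite {e \<in> Ed. diameter (snd e) > \<epsilon> \<and> diameter (snd (rv e)) > \<epsilon>}"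
proof -
  let ?S = "{s \<in> C. \<forall>H\<in>snd s. diameter H > \<epsilon>}"
  have "finite (\<Union>s\<in>?S. Pair (fst s) ` snd s)"
  proof (intro finite_UN_I finite_imageI)
    show "finite ?S" using fine assms unfolding fine_decomposition_def by blast
    show "finite (snd s)" if "s \<in> ?S" for s
      using splitting[of s] that unfolding elem_splitting_def by auto
  qed
  moreover have "{e \<in> Ed. diameter (snd e) > \<epsilon> \<and> diameter (snd (rv e)) > \<epsilon>}
    \<subseteq> (\<Union>s\<in>?S. Pair (fst s) ` snd s)"
  proof
    fix e assume e: "e \<in> {e \<in> Ed. diameter (snd e) > \<epsilon> \<and> diameter (snd (rv e)) > \<epsilon>}"
    then have "(fst e, {snd e, snd (rv e)}) \<in> ?S" using edge_in_C[of e] by auto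
    moreover have "e \<in> Pair (fst e) ` {snd e, snd (rv e)}" by (auto simp: image_iff prod_eq_iff)
    ultimately show "e \<in> (\<Union>s\<in>?S. Pair (fst s) ` snd s)" by force
  qed
  ultimately show ?thesis by (rule finite_subset[rotated])
qed

lemma diameter_half_pos:
  assumes "e \<in> Ed" shows "diameter (snd e) > 0"
proof -
  obtain a b where ab: "a \<in> snd e" "b \<in> snd e" "a \<noteq> b"
    using sep_psubset[OF assms] sep_ne[OF assms] by blast
  then have "0 < dist a b" by simp
  also have "\<dots> \<le> diameter (snd e)" using diameter_bound[OF compact_half[OF assms]] ab by blast
  finally show ?thesis .
qed

lemma diameter_subset_half: "e \<in> Ed \<Longrightarrow> S \<subseteq> snd e \<Longrightarrow> diameter S \<le> diameter (snd e)"
  using diameter_subset compact_imp_bounded compact_half by metis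

text \<open>Both halfspaces of an edge have positive diameter, so every edge belongs to one of the
  finite sets of \<open>finite_large_edges\<close>.\<close>

lemma countable_edges: "countable Ed"
proof -
  have "Ed \<subseteq> (\<Union>n. {e \<in> Ed. diameter (snd e) > 1 / real (Suc n) \<and> diameter (snd (rv e)) > 1 / real (Suc n)})"
  proof
    fix e assume e: "e \<in> Ed"
    then have "min (diameter (snd e)) (diameter (snd (rv e))) > 0"
      using diameter_half_pos rv_in by simp
    then obtain n where "1 / real (Suc n) < min (diameter (snd e)) (diameter (snd (rv e)))"
      using nat_approx_posE by blast
    then show "e \<in> (\<Union>n. {e \<in> Ed. diameter (snd e) > 1 / real (Suc n) \<and> diameter (snd (rv e)) > 1 / real (Suc n)})"
      using e by auto
  qed
  moreover have "countable \<dots>"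
    by (rule countable_UN[OF countableI_type]) (rule countable_finite, rule finite_large_edges, simp)
  ultimately show ?thesis by (rule countable_subset)
qed

lemma countable_V: "countable V"
proof -
  have "V = om ` Ed" using V_iff by blast
  then show ?thesis using countable_edges by simp
qed

lemma associated_tree_system: "tree_system V Ed al om rv (\<lambda>\<Omega>. \<Omega>) fst (\<lambda>e x. x)"
  unfolding tree_system_def
proof (intro conjI ballI allI impI)
  show "countable_tree V Ed al om rv" unfolding countable_tree_def using tree countable_V by blast
  fix t assume "t \<in> V"
  then show "compact t" by (rule compact_vertex)
next
  fix e assume e: "e \<in> Ed"
  then show "fst e \<noteq> {}" "compact (fst e)" "fst e \<subseteq> al e"
    using sep_ne compact_sep sep_subset_al by blast+
  show "homeomorphic_map (top_of_set (fst e)) (top_of_set (fst (rv e))) (\<lambda>x. x)"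
    using fst_rv[OF e] homeomorphic_map_id[of "top_of_set (fst e)" "top_of_set (fst e)"]
    by (simp add: id_def)
next
  fix t e e' assume "e \<in> out_edges_at Ed al t" "e' \<in> out_edges_at Ed al t" "e \<noteq> e'"
  then show "fst e \<inter> fst e' = {}"
    using outgoing_disjoint(1)[of e e'] sep_disjoint[of e e'] unfolding out_edges_at_def by auto
next
  fix t and \<epsilon> :: real assume "\<epsilon> > 0"
  \<comment> \<open>A separator lies in both of its halfspaces, so a large separator makes both
    large; halving turns the weak inequality into the strict one.\<close>
  have "{e \<in> out_edges_at Ed al t. \<epsilon> \<le> diameter (fst e)}
    \<subseteq> {e \<in> Ed. diameter (snd e) > \<epsilon> / 2 \<and> diameter (snd (rv e)) > \<epsilon> / 2}"
  proof
    fix e assume "e \<in> {e \<in> out_edges_at Ed al t. \<epsilon> \<le> diameter (fst e)}"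
    then have e: "e \<in> Ed" "\<epsilon> \<le> diameter (fst e)" unfolding out_edges_at_def by auto
    have "diameter (fst e) \<le> diameter (snd e)" "diameter (fst e) \<le> diameter (snd (rv e))"
      using diameter_subset_half rv_in sep_subset sep_subset_rv e(1) by blast+
    then show "e \<in> {e \<in> Ed. diameter (snd e) > \<epsilon> / 2 \<and> diameter (snd (rv e)) > \<epsilon> / 2}"
      using e \<open>\<epsilon> > 0\<close> by auto
  qed
  then show "finite {e \<in> out_edges_at Ed al t. \<epsilon> \<le> diameter (fst e)}"
    using finite_large_edges[of "\<epsilon> / 2"] \<open>\<epsilon> > 0\<close> finite_subset by auto
qed auto

subsection \<open>Rays and ends\<close>

abbreviation "ray \<equiv> is_ray Ed al om rv"

definition lies_in_ray :: "'a \<Rightarrow> (nat \<Rightarrow> 'a set \<times> 'a set) \<Rightarrow> bool" where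
  "lies_in_ray x r \<longleftrightarrow> (\<forall>i. x \<in> snd (r i))"

lemma
  assumes "ray r"
  shows ray_edge: "r i \<in> Ed" and ray_step: "al (r (Suc i)) = om (r i)"
    and ray_reduced: "r (Suc i) \<noteq> rv (r i)"
  using assms unfolding is_ray_def by auto

lemma ray_nested: assumes "ray r" "i < j" shows "snd (r j) \<subseteq> snd (r i) - fst (r i)"
  using assms(2)
proof (induction j)
  case (Suc j)
  have "snd (r (Suc j)) \<subseteq> snd (r j) - fst (r j)"
    using consecutive_nested(2)[OF ray_edge[OF assms(1)] ray_edge[OF assms(1)] ray_step[OF assms(1)]
      ray_reduced[OF assms(1)]] .
  then show ?case using Suc by (cases "i = j") auto
qed simp

lemma ray_antimono: "ray r \<Longrightarrow> i \<le> j \<Longrightarrow> snd (r j) \<subseteq> snd (r i)"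
  using ray_nested[of r i j] by (cases "i = j") auto

lemma ray_inj: assumes "ray r" shows "inj r"
proof (rule linorder_inj_onI')
  fix i j :: nat assume "i < j"
  then have "snd (r j) \<subseteq> snd (r i) - fst (r i)" by (rule ray_nested[OF assms])
  then show "r i \<noteq> r j"
    using sep_subset[OF ray_edge[OF assms, of i]] sep_ne[OF ray_edge[OF assms, of i]]
    by (metis Diff_disjoint inf.absorb_iff1 subset_trans)
qed

lemma ray_diameter_small:
  assumes "ray r" "\<epsilon> > 0" obtains i where "diameter (snd (r i)) \<le> \<epsilon>"
proof -
  let ?d = "diameter (snd (rv (r 0)))"
  \<comment> \<open>\<open>?d\<close> is the diameter of a halfspace contained in every
    \<open>snd (rv (r i))\<close>. A threshold of at most half of it forces the small halfspace to
    be \<open>snd (r i)\<close>.\<close>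
  let ?e = "min \<epsilon> (?d / 2)"
  have d: "?d > 0" using diameter_half_pos rv_in ray_edge[OF assms(1)] by blast
  have "finite {e \<in> Ed. diameter (snd e) > ?e \<and> diameter (snd (rv e)) > ?e}"
    using finite_large_edges d assms(2) by simp
  moreover have "infinite (range r)" using ray_inj[OF assms(1)] range_inj_infinite by blast
  ultimately obtain i where i: "\<not> (diameter (snd (r i)) > ?e \<and> diameter (snd (rv (r i))) > ?e)"
    using ray_edge[OF assms(1)] by (metis (mono_tags, lifting) finite_subset image_subsetI mem_Collect_eq)
  have "snd (rv (r 0)) \<subseteq> snd (rv (r i))"
  proof (cases "i = 0")
    case False
    then have "snd (r i) \<subseteq> snd (r 0) - fst (r 0)" using ray_nested[OF assms(1)] by blast
    then show ?thesis
      using half_Un[OF ray_edge[OF assms(1)]] half_Int[OF ray_edge[OF assms(1)]] by blast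
  qed simp
  then have "?d \<le> diameter (snd (rv (r i)))"
    using diameter_subset_half rv_in ray_edge[OF assms(1)] by blast
  then have "diameter (snd (r i)) \<le> \<epsilon>" using i d by auto
  then show thesis using that by blast
qed

lemma ray_point_unique:
  assumes "ray r" "lies_in_ray x r" "lies_in_ray y r" shows "x = y"
proof (rule ccontr)
  assume "x \<noteq> y"
  then obtain i where "diameter (snd (r i)) \<le> dist x y / 2"
    using ray_diameter_small[OF assms(1), of "dist x y / 2"] by auto
  moreover have "dist x y \<le> diameter (snd (r i))"
    using diameter_bound[OF compact_half[OF ray_edge[OF assms(1)]]] assms unfolding lies_in_ray_def by blast
  moreover have "dist x y > 0" using \<open>x \<noteq> y\<close> by simp
  ultimately show False by linarith
qed

lemma ray_point_exists:
  assumes "ray r" shows "\<exists>x. lies_in_ray x r"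
proof -
  have "K \<inter> (\<Inter>i\<in>UNIV. snd (r i)) \<noteq> {}"
  proof (rule compact_imp_fip_image[OF compact_K])
    show "closed (snd (r i))" for i by (rule compact_imp_closed[OF compact_half[OF ray_edge[OF assms]]])
    fix I :: "nat set" assume I: "finite I"
    obtain m where m: "\<And>i. i \<in> I \<Longrightarrow> i \<le> m" 
      using I unfolding finite_nat_set_iff_bounded_le by blast
    have "snd (r m) \<subseteq> K \<inter> (\<Inter>i\<in>I. snd (r i))"
      using ray_antimono[OF assms] m half_subset[OF ray_edge[OF assms]] by blast
    then show "K \<inter> (\<Inter>i\<in>I. snd (r i)) \<noteq> {}"
      using sep_subset[OF ray_edge[OF assms]] sep_ne[OF ray_edge[OF assms]] by blast
  qed
  then show ?thesis unfolding lies_in_ray_def by blast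
qed

lemma lies_in_equivalent_ray:
  assumes "ray r" "ray s" "ray_equiv r s" "lies_in_ray x r" shows "lies_in_ray x s"
proof -
  from assms(3) obtain m n where mn: "\<And>k. r (m + k) = s (n + k)" unfolding ray_equiv_def by blast
  have "x \<in> snd (s i)" for i
  proof -
    have "x \<in> snd (s (n + i))" using mn[of i] assms(4) unfolding lies_in_ray_def by metis
    then show ?thesis using ray_antimono[OF assms(2), of i "n + i"] by auto
  qed
  then show ?thesis unfolding lies_in_ray_def by blast
qed

lemma equivalent_ray_from:
  assumes "ray r" "u \<in> V" obtains s where "ray s" "ray_equiv r s" "al (s 0) = u"
proof -
  obtain p where "epath al om Ed u p (al (r 0))"
    using epath_exists[OF assms(2) al_in_V[OF ray_edge[OF assms(1)]]] by blast
  then show thesis using ray_equiv_from_vertex[OF graph assms(1)] that by blast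
qed

text \<open>For a representative starting at \<open>u\<close>, the point lies in
  \<open>snd (s 0)\<close> off the separator, whereas \<open>u\<close> lies on the other
  side.\<close>

lemma ray_point_not_in_vertex:
  assumes "ray r" "lies_in_ray x r" "u \<in> V" shows "x \<notin> u"
proof
  assume x: "x \<in> u"
  obtain s where s: "ray s" "ray_equiv r s" "al (s 0) = u" using equivalent_ray_from[OF assms(1,3)] .
  have "x \<in> snd (s 0)" "x \<in> snd (s 1)"
    using lies_in_equivalent_ray[OF assms(1) s(1,2) assms(2)] unfolding lies_in_ray_def by blast+
  moreover have "snd (s 1) \<subseteq> snd (s 0) - fst (s 0)" using ray_nested[OF s(1), of 0 1] by simp
  moreover have "x \<in> snd (rv (s 0))" using x s al_subset[OF ray_edge[OF s(1)]] by blast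
  ultimately show False using half_Int[OF ray_edge[OF s(1)]] by blast
qed

text \<open>From a common starting vertex both rays must take the unique outgoing edge whose
  halfspace contains \<open>x\<close>.\<close>

lemma ray_equiv_of_common_point:
  assumes "ray r" "ray s" "lies_in_ray x r" "lies_in_ray x s" shows "ray_equiv r s"
proof -
  obtain t where t: "ray t" "ray_equiv s t" "al (t 0) = al (r 0)"
    using equivalent_ray_from[OF assms(2) al_in_V[OF ray_edge[OF assms(1)]]] .
  have xt: "lies_in_ray x t" using lies_in_equivalent_ray assms t by blast
  have eq: "t i = r i" if "al (t i) = al (r i)" for i
    using outgoing_disjoint(2)[OF ray_edge[OF t(1)] ray_edge[OF assms(1)] that] xt assms(3)
    unfolding lies_in_ray_def by blast
  have "al (t i) = al (r i)" for i
  proof (induction i)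
    case (Suc i)
    then show ?case using eq[of i] ray_step[OF t(1), of i] ray_step[OF assms(1), of i] by simp
  qed (rule t(3))
  then have "t = r" using eq by blast
  then show ?thesis using t ray_equiv_sym by blast
qed

lemma ray_to_point:
  assumes "x \<in> K" "\<And>u. u \<in> V \<Longrightarrow> x \<notin> u"
  obtains r where "ray r" "lies_in_ray x r"
proof -
  \<comment> \<open>Keeping \<open>x\<close> off the separator ensures that the next edge never
    turns back.\<close>
  define nxt where "nxt u = (SOME e. e \<in> Ed \<and> al e = u \<and> x \<in> snd e - fst e)" for u
  have nxt: "nxt u \<in> Ed \<and> al (nxt u) = u \<and> x \<in> snd (nxt u) - fst (nxt u)" if "u \<in> V" for u
    unfolding nxt_def
    by (rule someI_ex) (use exit_edge[OF that assms(1) assms(2)[OF that]] in \<open>simp add: Bex_def\<close>)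
  obtain s where "s \<in> C" using nonempty by blast
  then have "fst s \<in> seps C" unfolding seps_def by blast
  then obtain v where v: "v \<in> V" using ex_edge om_in_V by blast
  define r where "r = rec_nat (nxt v) (\<lambda>_ e. nxt (om e))"
  have r0: "r 0 = nxt v" and rS: "r (Suc i) = nxt (om (r i))" for i unfolding r_def by simp_all
  have r: "r i \<in> Ed \<and> x \<in> snd (r i) - fst (r i)" for i
  proof (induction i)
    case 0
    then show ?case using nxt[OF v] r0 by simp
  next
    case (Suc i)
    then show ?case using nxt[OF om_in_V] rS by simp
  qed
  have "ray r"
    unfolding is_ray_def
  proof (intro allI conjI)
    fix i
    show "r i \<in> Ed" using r by blast
    show "om (r i) = al (r (Suc i))" using nxt[OF om_in_V] r rS by metis
    have "x \<notin> snd (rv (r i))" using r[of i] half_Int by blast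
    then show "r (Suc i) \<noteq> rv (r i)" using r[of "Suc i"] by auto
  qed
  then show thesis using that r unfolding lies_in_ray_def by blast
qed

subsection \<open>The point map\<close>

abbreviation "E \<equiv> ends Ed al om rv"
abbreviation "LR \<equiv> lim_rel V Ed al om (\<lambda>\<Omega>. \<Omega>) fst (\<lambda>e x. x)"
abbreviation "L \<equiv> lim_points V Ed al om rv (\<lambda>\<Omega>. \<Omega>) fst (\<lambda>e x. x)"

text \<open>The point lies on both sides of the first edge of the path from \<open>u\<close> to
  \<open>v\<close>, hence on its separator, which all later halfspaces avoid; so the path has only
  one edge.\<close>

lemma two_vertices:
  assumes "u \<in> V" "v \<in> V" "x \<in> u" "x \<in> v" "u \<noteq> v"
  obtains e where "e \<in> Ed" "al e = u" "om e = v" "x \<in> fst e"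
proof -
  obtain p where p: "epath al om Ed u p v" "reduced rv p" using tree_path assms by blast
  with assms(5) obtain e q where q: "p = e # q" by (cases p) auto
  have e: "e \<in> Ed" "al e = u" using p q by auto
  have "x \<in> snd e" using reduced_path_nested(1)[of u e q v] p q assms(4) by blast
  moreover have "x \<in> snd (rv e)" using al_subset[OF e(1)] e assms(3) by blast
  ultimately have x: "x \<in> fst e" using half_Int e by blast
  have "q = []"
  proof (cases q)
    case (Cons f q')
    have "v \<subseteq> snd f" using reduced_path_nested(1)[of "om e" f q' v] p q Cons by auto
    moreover have "snd f \<subseteq> snd e - fst e" using reduced_path_nested(2)[of u e q v f] p q Cons by auto
    ultimately show ?thesis using x assms(4) by blast
  qed
  then show thesis using that e x p q by auto
qed

definition fibre :: "'a \<Rightarrow> ('a set \<times> 'a) set" where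
  "fibre x = {(v, x) | v. v \<in> V \<and> x \<in> v}"

text \<open>Gluing changes the vertex but never the point, and any two domains containing
  \<open>x\<close> are joined by one edge with \<open>x\<close> on its separator; so the class
  consists of all copies of \<open>x\<close>.\<close>

lemma lim_class:
  assumes "u \<in> V" "x \<in> u" shows "LR `` {(u, x)} = fibre x"
proof
  have "q \<in> fibre x" if "((u, x), q) \<in> LR" for q
    using that unfolding lim_rel_def
  proof (induction rule: rtrancl_induct)
    case base
    then show ?case using assms unfolding fibre_def by blast
  next
    case (step p q)
    consider "p = q" | "(p, q) \<in> glue Ed al om fst (\<lambda>e x. x)" | "(q, p) \<in> glue Ed al om fst (\<lambda>e x. x)"
      using step(2) by auto
    then show ?case
    proof cases
      case 1
      then show ?thesis using step by simp
    next
      case 2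
      then obtain e y where "e \<in> Ed" "y \<in> fst e" "p = (al e, y)" "q = (om e, y)"
        unfolding glue_def by blast
      then show ?thesis using step(3) om_in_V sep_subset_om unfolding fibre_def by blast
    next
      case 3
      then obtain e y where "e \<in> Ed" "y \<in> fst e" "q = (al e, y)" "p = (om e, y)"
        unfolding glue_def by blast
      then show ?thesis using step(3) al_in_V sep_subset_al unfolding fibre_def by blast
    qed
  qed
  then show "LR `` {(u, x)} \<subseteq> fibre x" by blast
next
  have "((u, x), (v, x)) \<in> LR" if v: "v \<in> V" "x \<in> v" for v
  proof (cases "u = v")
    case False
    then obtain e where "e \<in> Ed" "al e = u" "om e = v" "x \<in> fst e" using two_vertices assms v by blast
    then have "((u, x), (v, x)) \<in> glue Ed al om fst (\<lambda>e x. x)" unfolding glue_def by blast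
    then show ?thesis unfolding lim_rel_def by blast
  qed (simp add: lim_rel_def)
  then show "fibre x \<subseteq> LR `` {(u, x)}" unfolding fibre_def by blast
qed

lemma lim_classes: "dunion V (\<lambda>\<Omega>. \<Omega>) // LR = {fibre x | x. \<exists>u\<in>V. x \<in> u}"
proof -
  have "dunion V (\<lambda>\<Omega>. \<Omega>) // LR = {LR `` {(u, x)} | u x. u \<in> V \<and> x \<in> u}"
    unfolding quotient_def dunion_def by auto
  also have "\<dots> = {fibre x | x. \<exists>u\<in>V. x \<in> u}" using lim_class by (metis (no_types, lifting))
  finally show ?thesis .
qed

lemma decomp_map_fibre:
  assumes "u \<in> V" "x \<in> u" shows "decomp_map (Inl (fibre x)) = x"
proof -
  have "(u, x) \<in> fibre x" using assms unfolding fibre_def by blast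
  then have "(SOME q. q \<in> fibre x) \<in> fibre x" by (rule someI)
  then show ?thesis unfolding decomp_map_def fibre_def by auto
qed

lemma end_ray: "\<xi> \<in> E \<Longrightarrow> r \<in> \<xi> \<Longrightarrow> ray r"
  unfolding ends_def by blast

lemma end_nonempty: "\<xi> \<in> E \<Longrightarrow> \<exists>r. r \<in> \<xi>"
  unfolding ends_def using ray_equiv_refl by blast

lemma end_closed: "\<xi> \<in> E \<Longrightarrow> r \<in> \<xi> \<Longrightarrow> ray s \<Longrightarrow> ray_equiv r s \<Longrightarrow> s \<in> \<xi>"
  unfolding ends_def using ray_equiv_trans by blast

lemma end_equiv: "\<xi> \<in> E \<Longrightarrow> r \<in> \<xi> \<Longrightarrow> s \<in> \<xi> \<Longrightarrow> ray_equiv r s"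
  unfolding ends_def using ray_equiv_trans ray_equiv_sym by blast

text \<open>\<open>decomp_map\<close> picks some representative ray, but equivalent rays shrink to
  the same point, so any member of the end may be used instead.\<close>

lemma decomp_map_end:
  assumes "\<xi> \<in> E" "r \<in> \<xi>" shows "lies_in_ray (decomp_map (Inr \<xi>)) r"
proof -
  let ?s = "SOME r. r \<in> \<xi>"
  have s: "?s \<in> \<xi>" using assms(2) by (rule someI[of "\<lambda>r. r \<in> \<xi>"])
  obtain x where x: "lies_in_ray x ?s" using ray_point_exists end_ray[OF assms(1) s] by blast
  have "decomp_map (Inr \<xi>) = (THE x. lies_in_ray x ?s)"
    unfolding decomp_map_def lies_in_ray_def by simp
  also have "\<dots> = x" using x ray_point_unique[OF end_ray[OF assms(1) s]] by (intro the_equality) auto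
  finally show ?thesis
    using lies_in_equivalent_ray[OF end_ray[OF assms(1) s] end_ray[OF assms]] x
      end_equiv[OF assms(1) s assms(2)] by simp
qed

text \<open>That points of ends avoid all domains settles the mixed case of injectivity.\<close>

lemma L_cases:
  assumes "p \<in> L"
  obtains (vertex) u x where "u \<in> V" "x \<in> u" "p = Inl (fibre x)" "decomp_map p = x"
  | (endpoint) \<xi> where "\<xi> \<in> E" "p = Inr \<xi>" "\<And>u. u \<in> V \<Longrightarrow> decomp_map p \<notin> u"
proof -
  from assms consider x u where "u \<in> V" "x \<in> u" "p = Inl (fibre x)" | \<xi> where "\<xi> \<in> E" "p = Inr \<xi>"
    unfolding lim_points_def lim_classes by blast
  then show thesis
  proof cases
    case 1
    then show thesis using decomp_map_fibre vertex by blast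
  next
    case 2
    obtain r where "r \<in> \<xi>" using end_nonempty 2 by blast
    then show thesis
      using 2 decomp_map_end ray_point_not_in_vertex end_ray endpoint by blast
  qed
qed

lemma inj_decomp_map: "inj_on decomp_map L"
proof (rule inj_onI)
  fix p q assume pq: "p \<in> L" "q \<in> L" "decomp_map p = decomp_map q"
  from pq(1) show "p = q"
  proof (cases rule: L_cases)
    case (vertex u x)
    from pq(2) show ?thesis by (cases rule: L_cases) (use vertex pq in auto)
  next
    case 1: (endpoint \<xi>)
    from pq(2) show ?thesis
    proof (cases rule: L_cases)
      case (vertex u x)
      then show ?thesis using 1 pq by auto
    next
      case 2: (endpoint \<eta>)
      obtain r s where rs: "r \<in> \<xi>" "s \<in> \<eta>"
        using end_nonempty[OF 1(1)] end_nonempty[OF 2(1)] by blast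
      have rays: "ray r" "ray s" using end_ray[OF 1(1) rs(1)] end_ray[OF 2(1) rs(2)] .
      have "ray_equiv r s"
        using ray_equiv_of_common_point[OF rays] decomp_map_end[of \<xi> r] decomp_map_end[of \<eta> s] rs 1 2 pq(3)
        by auto
      then have "s \<in> \<xi>" using end_closed[OF 1(1) rs(1) rays(2)] by blast
      then have "t \<in> \<xi> \<longleftrightarrow> t \<in> \<eta>" for t
        using end_closed[OF 1(1), of s t] end_closed[OF 2(1) rs(2), of t] end_equiv[OF 1(1), of s t]
          end_equiv[OF 2(1) rs(2), of t] end_ray[OF 1(1), of t] end_ray[OF 2(1), of t] by blast
      then have "\<xi> = \<eta>" by blast
      then show ?thesis using 1 2 by simp
    qed
  qed
qed

lemma decomp_map_image: "decomp_map ` L = K"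
proof
  show "decomp_map ` L \<subseteq> K"
  proof
    fix x assume "x \<in> decomp_map ` L"
    then obtain p where p: "p \<in> L" "x = decomp_map p" by blast
    from p(1) show "x \<in> K"
    proof (cases rule: L_cases)
      case (vertex u y)
      then show ?thesis using vertex_subset[OF vertex(1)] p(2) by auto
    next
      case (endpoint \<xi>)
      obtain r where r: "r \<in> \<xi>" using end_nonempty[OF endpoint(1)] by blast
      have "x \<in> snd (r 0)"
        using decomp_map_end[OF endpoint(1) r] endpoint(2) p(2) unfolding lies_in_ray_def by simp
      then show ?thesis using half_subset[OF ray_edge[OF end_ray[OF endpoint(1) r]]] by blast
    qed
  qed
next
  show "K \<subseteq> decomp_map ` L"
  proof
    fix x assume x: "x \<in> K"
    show "x \<in> decomp_map ` L"
    proof (cases "\<exists>u\<in>V. x \<in> u")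
      case True
      then obtain u where u: "u \<in> V" "x \<in> u" by blast
      then have "Inl (fibre x) \<in> L" unfolding lim_points_def lim_classes by blast
      then show ?thesis using decomp_map_fibre[OF u] by (metis imageI)
    next
      case False
      then obtain r where r: "ray r" "lies_in_ray x r" using ray_to_point x by blast
      let ?\<xi> = "{s. ray s \<and> ray_equiv r s}"
      have \<xi>: "?\<xi> \<in> E" "r \<in> ?\<xi>" using r ray_equiv_refl unfolding ends_def by blast+
      have "decomp_map (Inr ?\<xi>) = x"
        by (rule ray_point_unique[OF r(1) decomp_map_end[OF \<xi>] r(2)])
      moreover have "Inr ?\<xi> \<in> L" using \<xi>(1) unfolding lim_points_def by (intro UnI2 imageI)
      ultimately show ?thesis by (rule image_eqI[OF sym])
    qed
  qed
qed


subsection \<open>Edges leaving a finite subtree\<close>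

abbreviation "subtree \<equiv> finite_subtree V Ed al om rv"
abbreviation "leaving \<equiv> leaving_edges Ed al om"

lemma leavingD:
  assumes "e \<in> leaving F" shows "e \<in> Ed" "al e \<in> F" "om e \<notin> F"
  using assms unfolding leaving_edges_def by auto

lemma subtreeD: assumes "subtree F" shows "F \<subseteq> V" "F \<noteq> {}" "finite F"
  using assms unfolding finite_subtree_def by auto

text \<open>The tree path from \<open>al e\<close> to \<open>s\<close> starts with an edge whose
  halfspace contains the nonempty set \<open>s\<close>. So does \<open>snd e\<close>, hence that
  edge is \<open>e\<close>.\<close>

lemma path_into_half:
  assumes "e \<in> Ed" "s \<in> V" "s \<subseteq> snd e"
  obtains q where "epath al om Ed (al e) (e # q) s" "reduced rv (e # q)"
proof -
  obtain p where p: "epath al om Ed (al e) p s" "reduced rv p"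
    using tree_path[OF al_in_V[OF assms(1)] assms(2)] .
  have "al e \<noteq> s" using vertex_not_both_sides[OF assms(2,1,3)] al_subset[OF assms(1)] by blast
  then obtain f q where q: "p = f # q" using p by (cases p) auto
  have f: "f \<in> Ed" "al f = al e" using p q by auto
  have "s \<subseteq> snd f" using reduced_path_nested(1)[of "al e" f q s] p q by simp
  then have "snd e \<inter> snd f \<noteq> {}" using vertex_nonempty[OF assms(2)] assms(3) by blast
  then have "f = e" using outgoing_disjoint(2)[OF assms(1) f(1)] f by auto
  then show thesis using that p q by blast
qed

text \<open>A finite subtree is convex: with \<open>s\<close> it would contain \<open>om e\<close>,
  which lies on the path from \<open>al e\<close> to \<open>s\<close>.\<close>

lemma leaving_half_avoids:
  assumes "subtree F" "e \<in> leaving F" "s \<in> V" "s \<subseteq> snd e" shows "s \<notin> F"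
proof
  assume s: "s \<in> F"
  obtain q where "epath al om Ed (al e) (e # q) s" "reduced rv (e # q)"
    using path_into_half[OF leavingD(1)[OF assms(2)] assms(3,4)] .
  then have "\<forall>f\<in>set (e # q). om f \<in> F"
    using assms(1) s leavingD(2)[OF assms(2)] unfolding finite_subtree_def by blast
  then show False using leavingD(3)[OF assms(2)] by simp
qed

lemma subtree_vertex_side:
  assumes "subtree F" "e \<in> leaving F" "t \<in> F" shows "t \<subseteq> snd (rv e)"
  using vertex_side[OF _ leavingD(1)[OF assms(2)]] leaving_half_avoids[OF assms(1,2)] subtreeD(1)[OF assms(1)] assms(3)
  by blast

lemma leaving_half_Int_vertex:
  assumes "subtree F" "e \<in> leaving F" "t \<in> F" "x \<in> t" "x \<in> snd e" shows "x \<in> fst e"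
  using subtree_vertex_side[OF assms(1-3)] assms(4,5) half_Int[OF leavingD(1)[OF assms(2)]] by blast

text \<open>Each of the two separators lies in a domain of \<open>F\<close>, and all domains of
  \<open>F\<close> lie on the near side of the other edge.\<close>

lemma leaving_disjoint:
  assumes "subtree F" "e \<in> leaving F" "f \<in> leaving F" "e \<noteq> f" shows "snd e \<inter> snd f = {}"
proof (rule halves_disjoint)
  note e = leavingD[OF assms(2)] and f = leavingD[OF assms(3)]
  show "e \<in> Ed" "f \<in> Ed" by fact+
  show "fst e \<noteq> fst f"
  proof
    assume "fst e = fst f"
    then have "f = rv e" using edge_same_sep[OF e(1) f(1)] assms(4) by auto
    then show False using e f al_rv by auto
  qed
  show "fst e \<subseteq> snd (rv f)" "fst f \<subseteq> snd (rv e)"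
    using subtree_vertex_side[OF assms(1,2) f(2)] subtree_vertex_side[OF assms(1,3) e(2)]
      sep_subset_al e f by blast+
qed

text \<open>Translates the path condition in \<open>Gset\<close> into an inclusion of subsets of K,
  so that G(U) can be compared with a subset of K.\<close>

lemma beyond_iff:
  assumes "subtree F" "e \<in> leaving F" "t \<in> V"
  shows "beyond Ed al om rv F e t \<longleftrightarrow> t \<subseteq> snd e"
proof
  assume "beyond Ed al om rv F e t"
  then show "t \<subseteq> snd e" unfolding beyond_def using reduced_path_nested(1) by blast
next
  assume t: "t \<subseteq> snd e"
  obtain q where q: "epath al om Ed (al e) (e # q) t" "reduced rv (e # q)"
    using path_into_half[OF leavingD(1)[OF assms(2)] assms(3) t] .
  have edges: "f \<in> Ed" if "epath al om Ed u p v" "f \<in> set p" for u p v f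
    using that by (induction p arbitrary: u) auto
  have "om f \<notin> F" if f: "f \<in> set (e # q)" for f
  proof (rule leaving_half_avoids[OF assms(1,2)])
    have fE: "f \<in> Ed" using edges[OF q(1) f] .
    then show "om f \<in> V" by (rule om_in_V)
    have "snd f \<subseteq> snd e" using f reduced_path_nested(2)[OF q, of f] by auto
    then show "om f \<subseteq> snd e" using om_subset[OF fE] by blast
  qed
  then show "beyond Ed al om rv F e t" unfolding beyond_def using q by blast
qed

lemma leaving_cover:
  assumes "subtree F" "x \<in> K" "\<And>t. t \<in> F \<Longrightarrow> x \<notin> t"
  shows "\<exists>e\<in>leaving F. x \<in> snd e"
proof -
  \<comment> \<open>The edges from \<open>F\<close> that point at \<open>x\<close>: exactly one per
    vertex of \<open>F\<close>, hence finitely many. One with minimal halfspace leaves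
    \<open>F\<close>, since otherwise the exit edge at its end would have a smaller
    halfspace.\<close>
  let ?D = "{e \<in> Ed. al e \<in> F \<and> x \<in> snd e - fst e}"
  have ex: "\<exists>d\<in>?D. al d = t" if "t \<in> F" for t
    using exit_edge[OF _ assms(2) assms(3)[OF that]] subtreeD(1)[OF assms(1)] that by blast
  have "inj_on al ?D"
    using outgoing_disjoint(2) by (intro inj_onI) blast
  moreover have "finite (al ` ?D)" using subtreeD(3)[OF assms(1)] by (rule finite_subset[rotated]) blast
  ultimately have "finite (snd ` ?D)" using finite_imageD by blast
  moreover have "snd ` ?D \<noteq> {}" using ex subtreeD(2)[OF assms(1)] by blast
  ultimately have "\<exists>H\<in>snd ` ?D. \<not> (\<exists>J\<in>snd ` ?D. J \<subset> H)" by (rule ex_min_if_finite)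
  then obtain H where H: "H \<in> snd ` ?D" "\<not> (\<exists>J\<in>snd ` ?D. J \<subset> H)" by blast
  then obtain e where e: "e \<in> Ed" "al e \<in> F" "x \<in> snd e - fst e" "H = snd e" by blast
  have "om e \<notin> F"
  proof
    assume "om e \<in> F"
    then obtain d where d: "d \<in> ?D" "al d = om e" using ex by blast
    have dE: "d \<in> Ed" "x \<in> snd d" using d(1) by auto
    have "x \<notin> snd (rv e)" using e(3) half_Int[OF e(1)] by blast
    then have "d \<noteq> rv e" using dE by auto
    then have "snd d \<subseteq> snd e - fst e" using consecutive_nested(2)[OF e(1) dE(1) d(2)] by blast
    then have "snd d \<subset> H" using e(4) sep_ne[OF e(1)] sep_subset[OF e(1)] by blast
    moreover have "snd d \<in> snd ` ?D" using d(1) by (rule imageI)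
    ultimately show False using H(2) by blast
  qed
  then have "e \<in> leaving F" using e unfolding leaving_edges_def by blast
  then show ?thesis using e by blast
qed

lemma finite_large_leaving:
  assumes "subtree F" "\<epsilon> > 0" shows "finite {e \<in> leaving F. diameter (snd e) > \<epsilon>}"
proof (cases "leaving F = {}")
  case False
  then obtain e where e: "e \<in> leaving F" by blast
  \<comment> \<open>Every other leaving edge has \<open>snd e\<close> inside its complementary
    halfspace; with at most half the diameter of \<open>snd e\<close> as bound, that complement
    counts as large.\<close>
  let ?d = "min \<epsilon> (diameter (snd e) / 2)"
  have d: "?d > 0" using assms(2) diameter_half_pos[OF leavingD(1)[OF e]] by simp
  have "{e \<in> leaving F. diameter (snd e) > \<epsilon>}
    \<subseteq> insert e {f \<in> Ed. diameter (snd f) > ?d \<and> diameter (snd (rv f)) > ?d}"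
  proof
    fix f assume f: "f \<in> {e \<in> leaving F. diameter (snd e) > \<epsilon>}"
    show "f \<in> insert e {f \<in> Ed. diameter (snd f) > ?d \<and> diameter (snd (rv f)) > ?d}"
    proof (cases "f = e")
      case False
      have fE: "f \<in> Ed" using f leavingD(1) by blast
      have "snd e \<inter> snd f = {}" using leaving_disjoint[OF assms(1) e] f False by blast
      then have "snd e \<subseteq> snd (rv f)" using half_subset[OF leavingD(1)[OF e]] half_Un[OF fE] by blast
      then have "diameter (snd e) \<le> diameter (snd (rv f))" using diameter_subset_half rv_in fE by blast
      then show ?thesis using f fE d by auto
    qed simp
  qed
  then show ?thesis using finite_large_edges[OF d] finite_subset by auto
qed simp

lemma closed_Un_leaving_halves:
  assumes "subtree F" "closed S" "I \<subseteq> leaving F" "\<And>e. e \<in> I \<Longrightarrow> snd e \<inter> S \<noteq> {}"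
  shows "closed (S \<union> (\<Union>e\<in>I. snd e))"
proof (rule closed_Un_null_family[OF assms(2)])
  show "closed (snd e) \<and> bounded (snd e) \<and> snd e \<inter> S \<noteq> {}" if "e \<in> I" for e
    using compact_half[OF leavingD(1)] that assms(3,4) compact_imp_closed compact_imp_bounded by blast
  show "finite {e \<in> I. diameter (snd e) > \<epsilon>}" if "\<epsilon> > 0" for \<epsilon>
    by (rule finite_subset[OF _ finite_large_leaving[OF assms(1) that]]) (use assms(3) in blast)
qed

subsection \<open>The topology of the limit\<close>

abbreviation "adm \<equiv> admissible V Ed al om rv (\<lambda>\<Omega>. \<Omega>) fst (\<lambda>e x. x)"
abbreviation "G \<equiv> Gset V Ed al om rv (\<lambda>\<Omega>. \<Omega>) fst (\<lambda>e x. x)"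

definition trace_edges :: "'a set set \<Rightarrow> ('a set \<times> 'a) set \<Rightarrow> ('a set \<times> 'a set) set" where
  "trace_edges F U = {e \<in> leaving F. \<forall>y\<in>fst e. (al e, y) \<in> U}"

text \<open>The image of G(U) in K. Points of ends are already covered by the halfspaces.\<close>

definition trace :: "'a set set \<Rightarrow> ('a set \<times> 'a) set \<Rightarrow> 'a set" where
  "trace F U = snd ` U \<union> (\<Union>e\<in>trace_edges F U. snd e)"

lemma admissible_subtree: "adm F U \<Longrightarrow> subtree F"
  unfolding admissible_def by blast

lemma admissible_mem: "adm F U \<Longrightarrow> (t, x) \<in> U \<Longrightarrow> t \<in> F \<and> x \<in> t"
  unfolding admissible_def by blast

text \<open>The gluing condition concerns single edges, but two domains sharing a point are adjacent
  along an edge with that point on its separator.\<close>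

lemma admissible_consistent:
  assumes "adm F U" "t \<in> F" "t' \<in> F" "x \<in> t" "x \<in> t'" "(t, x) \<in> U" shows "(t', x) \<in> U"
proof (cases "t = t'")
  case False
  have "t \<in> V" "t' \<in> V" using subtreeD(1)[OF admissible_subtree[OF assms(1)]] assms(2,3) by blast+
  then obtain e where "e \<in> Ed" "al e = t" "om e = t'" "x \<in> fst e"
    using two_vertices[OF _ _ assms(4,5) False] by blast
  then show ?thesis using assms(1,2,3,6) unfolding admissible_def by blast
qed (use assms in simp)

lemma admissible_leaving:
  assumes "adm F U" "e \<in> leaving F" "e \<notin> trace_edges F U" "x \<in> fst e" shows "(al e, x) \<notin> U"
  using assms unfolding admissible_def trace_edges_def by blast

lemma G_subset: "G F U \<subseteq> L"
  unfolding Gset_def lim_points_def by blast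

lemma fibre_in_G_iff:
  assumes "u \<in> V" "x \<in> u"
  shows "Inl (fibre x) \<in> G F U \<longleftrightarrow>
    (\<exists>t\<in>V. x \<in> t \<and> ((t, x) \<in> U \<or> (\<exists>e\<in>trace_edges F U. beyond Ed al om rv F e t)))"
proof -
  have "fibre x \<in> dunion V (\<lambda>\<Omega>. \<Omega>) // LR" using assms unfolding lim_classes by blast
  then have "Inl (fibre x) \<in> G F U \<longleftrightarrow>
    (\<exists>(t, y)\<in>fibre x. (t, y) \<in> U \<or> (\<exists>e\<in>trace_edges F U. beyond Ed al om rv F e t))"
    unfolding Gset_def trace_edges_def by (simp add: Bex_def conj_assoc)
  also have "\<dots> \<longleftrightarrow> (\<exists>t\<in>V. x \<in> t \<and> ((t, x) \<in> U \<or> (\<exists>e\<in>trace_edges F U. beyond Ed al om rv F e t)))"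
    unfolding fibre_def by blast
  finally show ?thesis .
qed

lemma end_in_G_iff:
  assumes "\<xi> \<in> E"
  shows "Inr \<xi> \<in> G F U \<longleftrightarrow> (\<exists>r\<in>\<xi>. r 0 \<in> trace_edges F U \<and> (\<forall>i\<ge>1. al (r i) \<notin> F))"
  using assms unfolding Gset_def trace_edges_def by auto

lemma mem_G_iff:
  assumes "adm F U" "p \<in> L" shows "p \<in> G F U \<longleftrightarrow> decomp_map p \<in> trace F U"
  using assms(2)
proof (cases rule: L_cases)
  case (vertex u x)
  note F = admissible_subtree[OF assms(1)]
  have te: "e \<in> leaving F" if "e \<in> trace_edges F U" for e using that unfolding trace_edges_def by blast
  show ?thesis
  proof
    assume "p \<in> G F U"
    then obtain t where t: "t \<in> V" "x \<in> t"
      "(t, x) \<in> U \<or> (\<exists>e\<in>trace_edges F U. beyond Ed al om rv F e t)"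
      using fibre_in_G_iff[OF vertex(1,2)] vertex(3) by blast
    from t(3) show "decomp_map p \<in> trace F U"
    proof
      assume "(t, x) \<in> U"
      then show ?thesis using vertex(4) unfolding trace_def by force
    next
      assume "\<exists>e\<in>trace_edges F U. beyond Ed al om rv F e t"
      then obtain e where e: "e \<in> trace_edges F U" "t \<subseteq> snd e"
        using beyond_iff[OF F te t(1)] by blast
      then show ?thesis using t(2) vertex(4) unfolding trace_def by blast
    qed
  next
    assume "decomp_map p \<in> trace F U"
    then consider t where "(t, x) \<in> U" | e where "e \<in> trace_edges F U" "x \<in> snd e"
      unfolding trace_def vertex(4) by auto
    then have "\<exists>t\<in>V. x \<in> t \<and> ((t, x) \<in> U \<or> (\<exists>e\<in>trace_edges F U. beyond Ed al om rv F e t))"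
    proof cases
      case 1
      then show ?thesis using admissible_mem[OF assms(1) 1] subtreeD(1)[OF F] by blast
    next
      case 2
      note e = leavingD[OF te[OF 2(1)]]
      show ?thesis
      proof (cases "u \<subseteq> snd e")
        case True
        then show ?thesis using beyond_iff[OF F te[OF 2(1)] vertex(1)] 2 vertex by blast
      next
        case False
        \<comment> \<open>If \<open>u\<close> is not beyond \<open>e\<close>, the point lies on the
          separator, and its copy in \<open>al e\<close> belongs to \<open>U\<close>.\<close>
        then have "x \<in> fst e" using vertex_side[OF vertex(1) e(1)] vertex(2) 2 half_Int[OF e(1)] by blast
        then have "(al e, x) \<in> U" "x \<in> al e"
          using 2(1) sep_subset_al[OF e(1)] unfolding trace_edges_def by blast+
        then show ?thesis using al_in_V[OF e(1)] by blast
      qed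
    qed
    then show "p \<in> G F U" using fibre_in_G_iff[OF vertex(1,2)] vertex(3) by blast
  qed
next
  case (endpoint \<xi>)
  note F = admissible_subtree[OF assms(1)]
  have te: "e \<in> leaving F" if "e \<in> trace_edges F U" for e using that unfolding trace_edges_def by blast
  show ?thesis
  proof
    assume "p \<in> G F U"
    then obtain r where r: "r \<in> \<xi>" "r 0 \<in> trace_edges F U"
      using end_in_G_iff[OF endpoint(1)] endpoint(2) by blast
    have "decomp_map p \<in> snd (r 0)"
      using decomp_map_end[OF endpoint(1) r(1)] endpoint(2) unfolding lies_in_ray_def by simp
    then show "decomp_map p \<in> trace F U" using r(2) unfolding trace_def by blast
  next
    assume "decomp_map p \<in> trace F U"
    moreover have "decomp_map p \<notin> snd ` U"
      using admissible_mem[OF assms(1)] subtreeD(1)[OF F] endpoint(3) by fastforce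
    ultimately obtain e where e: "e \<in> trace_edges F U" "decomp_map p \<in> snd e"
      unfolding trace_def by blast
    note eE = leavingD[OF te[OF e(1)]]
    obtain r where r: "r \<in> \<xi>" using end_nonempty[OF endpoint(1)] by blast
    \<comment> \<open>Restarted at \<open>al e\<close>, the ray must begin with \<open>e\<close>,
      the only edge there whose halfspace contains the point.\<close>
    obtain s where s: "ray s" "ray_equiv r s" "al (s 0) = al e"
      using equivalent_ray_from[OF end_ray[OF endpoint(1) r] al_in_V[OF eE(1)]] .
    have s\<xi>: "s \<in> \<xi>" by (rule end_closed[OF endpoint(1) r s(1,2)])
    have "decomp_map p \<in> snd (s 0)"
      using decomp_map_end[OF endpoint(1) s\<xi>] endpoint(2) unfolding lies_in_ray_def by simp
    then have s0: "s 0 = e"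
      using outgoing_disjoint(2)[OF ray_edge[OF s(1)] eE(1) s(3)] e(2) by blast
    have "al (s i) \<notin> F" if i: "i \<ge> 1" for i
    proof (rule leaving_half_avoids[OF F te[OF e(1)]])
      show "al (s i) \<in> V" by (rule al_in_V[OF ray_edge[OF s(1)]])
      obtain j where j: "i = Suc j" using i by (cases i) auto
      have "al (s i) = om (s j)" using ray_step[OF s(1)] j by simp
      also have "\<dots> \<subseteq> snd (s j)" by (rule om_subset[OF ray_edge[OF s(1)]])
      also have "\<dots> \<subseteq> snd e" using ray_antimono[OF s(1), of 0 j] s0 by simp
      finally show "al (s i) \<subseteq> snd e" .
    qed
    then show "p \<in> G F U" using end_in_G_iff[OF endpoint(1)] endpoint(2) s\<xi> s0 e(1) by blast
  qed
qed

lemma trace_subset: assumes "adm F U" shows "trace F U \<subseteq> K"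
proof -
  have "snd ` U \<subseteq> K"
    using admissible_mem[OF assms] subtreeD(1)[OF admissible_subtree[OF assms]] vertex_subset by fastforce
  moreover have "snd e \<subseteq> K" if "e \<in> trace_edges F U" for e
    using that half_subset leavingD(1) unfolding trace_edges_def by blast
  ultimately show ?thesis unfolding trace_def by blast
qed

text \<open>The complement of the trace is a closed part of the partial union together with the halfspaces
  behind the remaining edges; these form a null family, and each of them meets that closed part in
  its separator.\<close>

lemma openin_trace:
  assumes "adm F U" shows "openin (top_of_set K) (trace F U)"
proof -
  note F = admissible_subtree[OF assms]
  let ?S = "\<Union>t\<in>F. t - {x. (t, x) \<in> U}"
  let ?I = "leaving F - trace_edges F U"
  have "closed ?S"
  proof (intro closed_UN)
    show "finite F" by (rule subtreeD(3)[OF F])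
    show "\<forall>t\<in>F. closed (t - {x. (t, x) \<in> U})"
    proof
      fix t assume t: "t \<in> F"
      then have "openin (top_of_set t) {x. (t, x) \<in> U}" using assms unfolding admissible_def by blast
      then have "closedin (top_of_set t) (t - {x. (t, x) \<in> U})"
        by (metis closedin_diff closedin_topspace topspace_euclidean_subtopology)
      then show "closed (t - {x. (t, x) \<in> U})"
        using closedin_closed_trans compact_imp_closed compact_vertex subtreeD(1)[OF F] t by blast
    qed
  qed
  moreover have "snd e \<inter> ?S \<noteq> {}" if e: "e \<in> ?I" for e
  proof -
    have eE: "e \<in> Ed" "al e \<in> F" using e leavingD by blast+
    obtain y where y: "y \<in> fst e" using sep_ne[OF eE(1)] by blast
    then have "(al e, y) \<notin> U" using admissible_leaving[OF assms] e by blast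
    then show ?thesis using y eE sep_subset_al[OF eE(1)] sep_subset[OF eE(1)] by blast
  qed
  ultimately have cl: "closed (?S \<union> (\<Union>e\<in>?I. snd e))"
    by (intro closed_Un_leaving_halves[OF F]) auto
  have "K - trace F U = ?S \<union> (\<Union>e\<in>?I. snd e)"
  proof (intro subset_antisym subsetI)
    fix x assume x: "x \<in> K - trace F U"
    show "x \<in> ?S \<union> (\<Union>e\<in>?I. snd e)"
    proof (cases "\<exists>t\<in>F. x \<in> t")
      case True
      then obtain t where t: "t \<in> F" "x \<in> t" by blast
      have "x \<notin> snd ` U" using x unfolding trace_def by blast
      then have "(t, x) \<notin> U" by (metis image_eqI snd_conv)
      then show ?thesis using t by blast
    next
      case False
      then obtain e where "e \<in> leaving F" "x \<in> snd e" using leaving_cover[OF F, of x] x by blast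
      then show ?thesis using x unfolding trace_def by blast
    qed
  next
    fix x assume x: "x \<in> ?S \<union> (\<Union>e\<in>?I. snd e)"
    have xK: "x \<in> K"
    proof -
      have "?S \<subseteq> K" using vertex_subset subtreeD(1)[OF F] by blast
      moreover have "(\<Union>e\<in>?I. snd e) \<subseteq> K" using half_subset leavingD(1) by blast
      ultimately show ?thesis using x by blast
    qed
    have "x \<notin> trace F U"
    proof
      assume "x \<in> trace F U"
      then consider (U) t where "(t, x) \<in> U" | (half) e where "e \<in> trace_edges F U" "x \<in> snd e"
        unfolding trace_def by auto
      then show False
      proof cases
        case U
        note t = admissible_mem[OF assms U]
        from x show False
        proof
          assume "x \<in> ?S"
          then show False using admissible_consistent[OF assms, of t] t U by blast
        next
          assume "x \<in> (\<Union>e\<in>?I. snd e)"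
          then obtain e where e: "e \<in> leaving F" "e \<notin> trace_edges F U" "x \<in> snd e" by blast
          \<comment> \<open>Within a domain of \<open>F\<close>, a point beyond \<open>e\<close>
            lies on the separator of \<open>e\<close>, which here misses \<open>U\<close>
            completely.\<close>
          have xe: "x \<in> fst e" using leaving_half_Int_vertex[OF F e(1)] t e(3) by blast
          then have "(al e, x) \<notin> U" using admissible_leaving[OF assms e(1,2)] by blast
          then show False
            using admissible_consistent[OF assms, of t "al e" x] t U leavingD[OF e(1)] xe sep_subset_al by blast
        qed
      next
        case half
        have eF: "e \<in> leaving F" using half unfolding trace_edges_def by blast
        from x show False
        proof
          assume "x \<in> ?S"
          then obtain t where t: "t \<in> F" "x \<in> t" "(t, x) \<notin> U" by blast
          have xe: "x \<in> fst e" using leaving_half_Int_vertex[OF F eF t(1,2)] half by blast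
          then have "(al e, x) \<in> U" using half unfolding trace_edges_def by blast
          then show False
            using admissible_consistent[OF assms, of "al e" t x] t leavingD[OF eF] xe sep_subset_al by blast
        next
          assume "x \<in> (\<Union>e\<in>?I. snd e)"
          then obtain f where f: "f \<in> leaving F" "f \<notin> trace_edges F U" "x \<in> snd f" by blast
          then show False using leaving_disjoint[OF F eF f(1)] half by blast
        qed
      qed
    qed
    then show "x \<in> K - trace F U" using xK by blast
  qed
  then have "closedin (top_of_set K) (K - trace F U)"
    using cl by (metis Diff_subset closed_subset)
  then show ?thesis using trace_subset[OF assms] by (simp add: openin_closedin_eq)
qed

text \<open>Removing from \<open>W\<close> all halfspaces behind \<open>F\<close> that stick out of \<open>W\<close> leaves an open set,
  because these halfspaces are a null family and all meet the complement of \<open>W\<close>.\<close>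

lemma basic_neighbourhood:
  assumes "subtree F" "open W" "x \<in> W" "x \<in> K" "\<And>e. e \<in> leaving F \<Longrightarrow> x \<in> snd e \<Longrightarrow> snd e \<subseteq> W"
  obtains U where "adm F U" "x \<in> trace F U" "trace F U \<subseteq> W"
proof -
  define I where "I = {e \<in> leaving F. \<not> snd e \<subseteq> W}"
  define P where "P = - ((- W) \<union> (\<Union>e\<in>I. snd e))"
  define U where "U = {(t, y). t \<in> F \<and> y \<in> t \<and> y \<in> P}"
  have "closed ((- W) \<union> (\<Union>e\<in>I. snd e))"
    by (rule closed_Un_leaving_halves[OF assms(1)]) (use assms(2) in \<open>auto simp: I_def\<close>)
  then have "open P" unfolding P_def by (rule open_Compl)
  have P: "P \<subseteq> W" "\<And>e. e \<in> I \<Longrightarrow> snd e \<inter> P = {}" unfolding P_def by blast+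
  \<comment> \<open>Leaving halfspaces are pairwise disjoint, so removing those that stick out does
    not touch the others.\<close>
  have good: "snd e \<subseteq> P" if "e \<in> leaving F" "e \<notin> I" for e
  proof -
    have "snd e \<inter> snd f = {}" if "f \<in> I" for f
      using leaving_disjoint[OF assms(1), of e f] \<open>e \<in> leaving F\<close> \<open>e \<notin> I\<close> that unfolding I_def by blast
    moreover have "snd e \<subseteq> W" using that unfolding I_def by blast
    ultimately show ?thesis unfolding P_def by blast
  qed
  have te: "e \<in> trace_edges F U \<longleftrightarrow> e \<notin> I" if e: "e \<in> leaving F" for e
  proof
    obtain y where "y \<in> fst e" using sep_ne[OF leavingD(1)[OF e]] by blast
    then show "e \<notin> I" if "e \<in> trace_edges F U"
      using that P(2) sep_subset[OF leavingD(1)[OF e]] unfolding trace_edges_def U_def by blast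
    show "e \<in> trace_edges F U" if "e \<notin> I"
      using good[OF e that] e leavingD[OF e] sep_subset[OF leavingD(1)[OF e]] sep_subset_al[OF leavingD(1)[OF e]]
      unfolding trace_edges_def U_def by blast
  qed
  have "adm F U"
    unfolding admissible_def
  proof (intro conjI ballI impI)
    show "subtree F" by fact
    show "U \<subseteq> (SIGMA t:F. t)" unfolding U_def by blast
    show "openin (top_of_set t) {y. (t, y) \<in> U}" if "t \<in> F" for t
    proof -
      have "{y. (t, y) \<in> U} = t \<inter> P" using that unfolding U_def by blast
      then show ?thesis using \<open>open P\<close> by (simp add: openin_open_Int)
    qed
    show "(al e, y) \<in> U \<longleftrightarrow> (om e, y) \<in> U"
      if "e \<in> Ed" "al e \<in> F \<and> om e \<in> F" "y \<in> fst e" for e y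
      using that sep_subset_al sep_subset_om unfolding U_def by blast
    show "(\<forall>y\<in>fst e. (al e, y) \<in> U) \<or> (\<forall>y\<in>fst e. (al e, y) \<notin> U)" if e: "e \<in> leaving F" for e
    proof (cases "e \<in> I")
      case True
      then show ?thesis using P(2) sep_subset[OF leavingD(1)[OF e]] unfolding U_def by blast
    next
      case False
      then show ?thesis using te[OF e] unfolding trace_edges_def by blast
    qed
  qed
  moreover have "x \<in> trace F U"
  proof (cases "\<exists>t\<in>F. x \<in> t")
    case True
    have "x \<in> P" unfolding P_def using assms(3,5) unfolding I_def by blast
    then have "\<exists>t. (t, x) \<in> U" using True unfolding U_def by blast
    then show ?thesis unfolding trace_def by force
  next
    case False
    then obtain e where e: "e \<in> leaving F" "x \<in> snd e" 
      using leaving_cover[OF assms(1,4)] by blast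
    then have "e \<in> trace_edges F U" using te[OF e(1)] assms(5)[OF e] unfolding I_def by blast
    then show ?thesis using e unfolding trace_def by blast
  qed
  moreover have "trace F U \<subseteq> W"
  proof -
    have "snd ` U \<subseteq> W" using P(1) unfolding U_def by auto
    moreover have "snd e \<subseteq> W" if "e \<in> trace_edges F U" for e
      using that te unfolding I_def trace_edges_def by blast
    ultimately show ?thesis unfolding trace_def by blast
  qed
  ultimately show thesis using that by blast
qed

section \<open>Neighbourhoods in the limit\<close>

lemma subtree_singleton: assumes "u \<in> V" shows "subtree {u}"
proof -
  have "p = []" if "epath al om Ed u p u" "reduced rv p" for p
    using reduced_path_ne[of u] that by (cases p) auto
  then show ?thesis unfolding finite_subtree_def using assms by force
qed

text \<open>Uniqueness of reduced paths leaves only \<open>[]\<close>, \<open>[e]\<close> and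
  \<open>[rv e]\<close> between the two vertices.\<close>

lemma subtree_edge: assumes "e \<in> Ed" shows "subtree {al e, om e}"
proof -
  have "om f \<in> {al e, om e}"
    if p: "u \<in> {al e, om e}" "v \<in> {al e, om e}" "epath al om Ed u p v" "reduced rv p" "f \<in> set p"
    for u v p f
  proof -
    have v: "v \<in> V" using p(2) al_in_V om_in_V assms by blast
    have *: "p = q" if "epath al om Ed u q v" "reduced rv q" for q
      using reduced_path_unique[OF p(3,4) that v] .
    consider "u = v" | "u = al e" "v = om e" | "u = om e" "v = al e" using p(1,2) by blast
    then have "p = [] \<or> p = [e] \<or> p = [rv e]"
    proof cases
      case 1
      then show ?thesis using *[of "[]"] by simp
    next
      case 2
      then show ?thesis using *[of "[e]"] assms by simp
    next
      case 3
      then show ?thesis using *[of "[rv e]"] assms rv_in al_rv om_rv by simp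
    qed
    then have "f = e \<or> f = rv e" using p(5) by (elim disjE) simp_all
    then show ?thesis using om_rv[OF assms] by (elim disjE) simp_all
  qed
  then have "\<forall>u\<in>{al e, om e}. \<forall>v\<in>{al e, om e}. \<forall>p. epath al om Ed u p v \<and> reduced rv p
      \<longrightarrow> (\<forall>f\<in>set p. om f \<in> {al e, om e})"
    by (intro ballI allI impI) (elim conjE)
  then show ?thesis unfolding finite_subtree_def using al_in_V[OF assms] om_in_V[OF assms] by simp
qed

text \<open>\<open>F\<close> is chosen so that every leaving halfspace containing the point lies in
  \<open>W\<close>. For a point of a domain there is no such halfspace; for an end, one vertex far
  along a ray suffices.\<close>

lemma neighbourhood:
  assumes "p \<in> L" "open W" "decomp_map p \<in> W"
  obtains F U where "adm F U" "p \<in> G F U" "\<And>q. q \<in> G F U \<Longrightarrow> decomp_map q \<in> W"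
proof -
  have "\<exists>F. subtree F \<and> (\<forall>e\<in>leaving F. decomp_map p \<in> snd e \<longrightarrow> snd e \<subseteq> W)"
    using assms(1)
  proof (cases rule: L_cases)
    case (vertex u x)
    show ?thesis
    proof (cases "\<exists>v\<in>V. x \<in> v \<and> v \<noteq> u")
      case True
      \<comment> \<open>A point shared by two domains lies beyond an edge leaving \<open>u\<close>,
        so \<open>F\<close> contains both ends of that edge. As separators are disjoint, an edge
        leaving \<open>F\<close> cannot have \<open>x\<close> beyond it.\<close>
      then obtain e where e: "e \<in> Ed" "al e = u" "x \<in> fst e" using two_vertices vertex(1,2) by metis
      have F: "subtree {al e, om e}" by (rule subtree_edge[OF e(1)])
      have "x \<notin> snd f" if f: "f \<in> leaving {al e, om e}" for f
      proof
        assume "x \<in> snd f"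
        then have "x \<in> fst f" using leaving_half_Int_vertex[OF F f] e(2) vertex(2) by blast
        then have "fst f = fst e" using sep_disjoint[OF leavingD(1)[OF f] e(1)] e(3) by blast
        then have "f = e \<or> f = rv e" using edge_same_sep[OF e(1) leavingD(1)[OF f]] by blast
        then show False using leavingD(3)[OF f] om_rv[OF e(1)] by auto
      qed
      then show ?thesis using F vertex(4) by blast
    next
      case False
      have F: "subtree {u}" by (rule subtree_singleton[OF vertex(1)])
      have "x \<notin> snd f" if f: "f \<in> leaving {u}" for f
      proof
        assume "x \<in> snd f"
        then have "x \<in> fst f" using leaving_half_Int_vertex[OF F f] vertex(2) by blast
        then have "x \<in> om f" "om f \<in> V" using sep_subset_om om_in_V leavingD(1)[OF f] by blast+
        then show False using leavingD(3)[OF f] False by blast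
      qed
      then show ?thesis using F vertex(4) by blast
    qed
  next
    case (endpoint \<xi>)
    obtain r where r: "r \<in> \<xi>" using end_nonempty[OF endpoint(1)] by blast
    note ray = end_ray[OF endpoint(1) r]
    have x: "decomp_map p \<in> snd (r i)" for i
      using decomp_map_end[OF endpoint(1) r] endpoint(2) unfolding lies_in_ray_def by simp
    obtain d where d: "d > 0" "ball (decomp_map p) d \<subseteq> W" using openE[OF assms(2,3)] .
    obtain i where i: "diameter (snd (r i)) \<le> d / 2" using ray_diameter_small[OF ray, of "d / 2"] d by auto
    have "y \<in> W" if "y \<in> snd (r i)" for y
    proof -
      have "dist (decomp_map p) y \<le> diameter (snd (r i))"
        by (rule diameter_bound[OF compact_half[OF ray_edge[OF ray]] x that])
      then have "dist (decomp_map p) y < d" using i d(1) by linarith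
      then show ?thesis using d(2) by auto
    qed
    \<comment> \<open>Only one edge out of \<open>al (r i)\<close> has the point beyond it, and its
      halfspace is small.\<close>
    moreover have "f = r i" if "f \<in> leaving {al (r i)}" "decomp_map p \<in> snd f" for f
      using outgoing_disjoint(2)[OF leavingD(1)[OF that(1)] ray_edge[OF ray]] leavingD(2)[OF that(1)] that(2) x
      by blast
    ultimately show ?thesis
      using subtree_singleton[OF al_in_V[OF ray_edge[OF ray]]] by (intro exI[of _ "{al (r i)}"]) blast
  qed
  then obtain F where F: "subtree F" "\<And>e. e \<in> leaving F \<Longrightarrow> decomp_map p \<in> snd e \<Longrightarrow> snd e \<subseteq> W"
    by blast
  have "decomp_map p \<in> K" using decomp_map_image assms(1) by blast
  then obtain U where U: "adm F U" "decomp_map p \<in> trace F U" "trace F U \<subseteq> W"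
    using basic_neighbourhood[OF F(1) assms(2,3) _ F(2)] by blast
  show thesis
  proof (rule that[OF U(1)])
    show "p \<in> G F U" using mem_G_iff[OF U(1) assms(1)] U(2) by blast
    show "decomp_map q \<in> W" if "q \<in> G F U" for q
      using mem_G_iff[OF U(1), of q] G_subset that U(3) by blast
  qed
qed

section \<open>The homeomorphism from the limit to K\<close>

abbreviation "limtop \<equiv> lim_top V Ed al om rv (\<lambda>\<Omega>. \<Omega>) fst (\<lambda>e x. x)"

lemma openin_G: "adm F U \<Longrightarrow> openin limtop (G F U)"
  unfolding lim_top_def by (rule topology_generated_by_Basis) blast

lemma topspace_limtop: "topspace limtop = L"
proof
  show "topspace limtop \<subseteq> L"
    unfolding lim_top_def topology_generated_by_topspace using G_subset by blast
  show "L \<subseteq> topspace limtop"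
  proof
    fix p assume "p \<in> L"
    then obtain F U where "adm F U" "p \<in> G F U" using neighbourhood[of p UNIV] by auto
    then show "p \<in> topspace limtop" using openin_G openin_subset by blast
  qed
qed

lemma continuous_decomp_map: "continuous_map limtop (top_of_set K) decomp_map"
proof (rule continuous_map_into_subtopology)
  show "decomp_map \<in> topspace limtop \<rightarrow> K" using topspace_limtop decomp_map_image by blast
  show "continuous_map limtop euclidean decomp_map"
    unfolding continuous_map_def
  proof (intro conjI allI impI)
    fix W :: "'a set" assume W: "openin euclidean W"
    show "openin limtop {p \<in> topspace limtop. decomp_map p \<in> W}"
    proof (subst openin_subopen, intro ballI)
      fix p assume "p \<in> {p \<in> topspace limtop. decomp_map p \<in> W}"
      then have p: "p \<in> L" "decomp_map p \<in> W" using topspace_limtop by auto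
      obtain F U where FU: "adm F U" "p \<in> G F U" "\<And>q. q \<in> G F U \<Longrightarrow> decomp_map q \<in> W"
        using neighbourhood[OF p(1) _ p(2)] W by auto
      then show "\<exists>T. openin limtop T \<and> p \<in> T \<and> T \<subseteq> {p \<in> topspace limtop. decomp_map p \<in> W}"
        using openin_G[OF FU(1)] openin_subset by blast
    qed
  qed simp
qed

lemma image_G: assumes "adm F U" shows "decomp_map ` G F U = trace F U"
proof
  show "decomp_map ` G F U \<subseteq> trace F U" using mem_G_iff[OF assms] G_subset by blast
  show "trace F U \<subseteq> decomp_map ` G F U"
  proof
    fix x assume x: "x \<in> trace F U"
    then have "x \<in> decomp_map ` L" using trace_subset[OF assms] decomp_map_image by blast
    then obtain p where "p \<in> L" "x = decomp_map p" by blast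
    then show "x \<in> decomp_map ` G F U" using mem_G_iff[OF assms] x by blast
  qed
qed

lemma open_decomp_map: "open_map limtop (top_of_set K) decomp_map"
  unfolding open_map_def
proof (intro allI impI)
  fix W assume "openin limtop W"
  then have "generate_topology_on {G F U | F U. adm F U} W"
    unfolding lim_top_def by (simp add: openin_topology_generated_by_iff)
  \<comment> \<open>The sets G(U) enter as generators, so finite intersections have to be mapped
    too. \<open>W \<subseteq> L\<close> is carried along because it is on \<open>L\<close> that
    \<open>decomp_map\<close> is injective and images commute with intersections.\<close>
  then have "W \<subseteq> L \<and> openin (top_of_set K) (decomp_map ` W)"
  proof induction
    case Empty
    then show ?case by simp
  next
    case (Int A B)
    then have "decomp_map ` (A \<inter> B) = decomp_map ` A \<inter> decomp_map ` B"
      using inj_on_image_Int[OF inj_decomp_map] by blast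
    then show ?case using Int by auto
  next
    case (UN \<A>)
    then show ?case by (auto simp: image_Union intro!: openin_Union)
  next
    case (Basis A)
    then obtain F U where "adm F U" "A = G F U" by blast
    then show ?case using image_G openin_trace G_subset by simp
  qed
  then show "openin (top_of_set K) (decomp_map ` W)" by blast
qed

lemma homeomorphic_decomp_map: "homeomorphic_map limtop (top_of_set K) decomp_map"
  using continuous_decomp_map open_decomp_map decomp_map_image inj_decomp_map topspace_limtop
  by (intro bijective_open_imp_homeomorphic_map) simp_all

lemma end_unique_point:
  assumes "\<xi> \<in> E" "r \<in> \<xi>" shows "\<exists>!x. x \<in> (\<Inter>i. snd (r i))"
  using ray_point_exists[OF end_ray[OF assms]] ray_point_unique[OF end_ray[OF assms]]
  unfolding lies_in_ray_def by auto

end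

theorem theorem3:
  fixes K :: "'a::metric_space set"
    and C :: "('a set \<times> 'a set set) set"
  assumes "compact K"
    and "tree_decomposition K C"
    and "fine_decomposition C"
    and "C \<noteq> {}"
  shows "tree_system (dual_V C) (dual_O C) (dual_al C) (dual_om C) (dual_rv C)
           (\<lambda>\<Omega>. \<Omega>) fst (\<lambda>e x. x)
     \<and> (\<forall>\<xi>\<in>ends (dual_O C) (dual_al C) (dual_om C) (dual_rv C).
          \<forall>r\<in>\<xi>. \<exists>!x. x \<in> (\<Inter>i. snd (r i)))
     \<and> homeomorphic_map
         (lim_top (dual_V C) (dual_O C) (dual_al C) (dual_om C) (dual_rv C)
            (\<lambda>\<Omega>. \<Omega>) fst (\<lambda>e x. x))
         (top_of_set K) decomp_map"
proof -
  interpret fine_tree_decomposition K C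
    using assms by unfold_locales
  show ?thesis
    using associated_tree_system end_unique_point homeomorphic_decomp_map by blast
qed

end
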